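(* Let $\mathcal{H}=\{n^2:n\in\mathbb{N}\}$ and $N=K^2$ with $K\in\mathbb{N}$, and set $\varepsilon_N=\frac57|w_+|^{2K-4}$. Define $$L_N:=\frac16\sum_{j=0}^{\infty}\Bigl((K+1+j)^2-K^2-5\Bigr)\Bigl(\tfrac57-\varepsilon_N\Bigr)^j\Bigl(\tfrac27-\varepsilon_N\Bigr),$$ $$U_N:=\sum_{j=0}^{\infty}\Bigl((K+1+j)^2-K^2-1\Bigr)\Bigl(\tfrac57+\varepsilon_N\Bigr)^j\Bigl(\tfrac27+\varepsilon_N\Bigr).$$ Then, for all $K\ge4$ and every $s\in\{0,1,\dots,N\}$ with $\mathbb{P}_s(A_N)>0$, $$L_N<\mathbb{E}_s\bigl[T-\omega_N\,\big|\,A_N\bigr]<U_N.$$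
   Context: $\mathbb{N}=\{1,2,3,\dots\}$. Let $X_1,X_2,\dots$ be i.i.d. uniform on $\{1,\dots,6\}$. For $s\in\mathbb{Z}_{\ge0}$ let $S_t=s+\sum_{i=1}^tX_i$, $S_0=s$; $\mathbb{P}_s,\mathbb{E}_s$ denote probability and expectation with $S_0=s$. Define $T=\inf\{t\ge0:S_t\in\mathcal{H}\}$, $\omega_N=\inf\{t\ge0:S_t>N\}$ and $A_N=\{\omega_N<T\}$. The polynomial $6x^6-x^5-x^4-x^3-x^2-x-1$ has roots $1$, a real root $u\approx-0.6703320476$, and two complex conjugate pairs $v_\pm\approx-0.3756951992\pm0.5701751610\,i$ and $w_\pm\approx0.2941945564\pm0.6683670974\,i$; $|w_+|\approx0.7302499667$ is the modulus of $w_+$. *)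

theory Defs
  imports "HOL-Probability.Probability" "HOL-Computational_Algebra.Polynomial"
begin

definition squares :: "nat set" where
  "squares = {n\<^sup>2 | n. n \<ge> 1}"

text \<open>The family \<open>X\<close> is indexed by the natural numbers, but only \<open>X 1, X 2, \<dots>\<close> are used.\<close>

definition iid_dice :: "'a measure \<Rightarrow> (nat \<Rightarrow> 'a \<Rightarrow> nat) \<Rightarrow> bool" where
  "iid_dice M X \<longleftrightarrow> prob_space M
     \<and> prob_space.indep_vars M (\<lambda>_. count_space UNIV) X {1..}
     \<and> (\<forall>i\<ge>1. distr M (count_space UNIV) (X i) = measure_pmf (pmf_of_set {1..6}))"

definition walk :: "(nat \<Rightarrow> 'a \<Rightarrow> nat) \<Rightarrow> nat \<Rightarrow> nat \<Rightarrow> 'a \<Rightarrow> nat" where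
  "walk X s t x = s + (\<Sum>i=1..t. X i x)"

text \<open>Both times are extended naturals, the infimum of the empty set being \<open>\<infinity>\<close>.\<close>

definition hit_time :: "(nat \<Rightarrow> 'a \<Rightarrow> nat) \<Rightarrow> nat \<Rightarrow> nat set \<Rightarrow> 'a \<Rightarrow> enat" where
  "hit_time X s H x = (INF t\<in>{t. walk X s t x \<in> H}. enat t)"

definition exceed_time :: "(nat \<Rightarrow> 'a \<Rightarrow> nat) \<Rightarrow> nat \<Rightarrow> nat \<Rightarrow> 'a \<Rightarrow> enat" where
  "exceed_time X s N x = (INF t\<in>{t. walk X s t x > N}. enat t)"

definition survival_event ::
  "'a measure \<Rightarrow> (nat \<Rightarrow> 'a \<Rightarrow> nat) \<Rightarrow> nat \<Rightarrow> nat set \<Rightarrow> nat \<Rightarrow> 'a set" where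
  "survival_event M X s H N = {x \<in> space M. exceed_time X s N x < hit_time X s H x}"

text \<open>
  Expectation with respect to \<open>P(\<cdot> | A)\<close> of a nonnegative, possibly infinite random variable,
  for an event \<open>A\<close> of positive probability.
\<close>

definition cond_expectation :: "'a measure \<Rightarrow> 'a set \<Rightarrow> ('a \<Rightarrow> enat) \<Rightarrow> ereal" where
  "cond_expectation M A Y =
     enn2ereal (\<integral>\<^sup>+ x. ennreal_of_enat (Y x) \<partial>uniform_measure M A)"

text \<open>
  The decimals only single out one of the six roots; the tolerance exceeds their rounding error.
\<close>

definition w_plus :: complex where
  "w_plus = (THE z. poly [:-1, -1, -1, -1, -1, -1, 6:] z = 0
               \<and> cmod (z - Complex 0.2941945564 0.6683670974) < 1 / 10 ^ 9)"

text \<open>The following quantities are given as functions of \<open>K\<close>, where \<open>N = K\<^sup>2\<close>.\<close>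

definition eps :: "nat \<Rightarrow> real" where
  "eps K = 5 / 7 * cmod w_plus ^ (2 * K - 4)"

definition lower_bound :: "nat \<Rightarrow> real" where
  "lower_bound K = 1 / 6 *
     (\<Sum>j. ((real K + 1 + real j)\<^sup>2 - (real K)\<^sup>2 - 5) * (5 / 7 - eps K) ^ j * (2 / 7 - eps K))"

definition upper_bound :: "nat \<Rightarrow> real" where
  "upper_bound K =
     (\<Sum>j. ((real K + 1 + real j)\<^sup>2 - (real K)\<^sup>2 - 1) * (5 / 7 + eps K) ^ j * (2 / 7 + eps K))"

end

theory Submission
  imports Defs "HOL-Computational_Algebra.Fundamental_Theorem_Algebra" "HOL-Real_Asymp.Real_Asymp"
begin

text \<open>
  On the survival event the walk jumps over \<open>K\<^sup>2\<close> without having met a square. It lands on one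
  of \<open>K\<^sup>2 + 1, \<dots>, K\<^sup>2 + 5\<close>: a landing at \<open>K\<^sup>2 + 6\<close> would have to start from the square \<open>K\<^sup>2\<close>.
  If the first square met is \<open>(K + 1 + j)\<^sup>2\<close>, then the elapsed time \<open>n\<close> satisfies
  \<open>(K + 1 + j)\<^sup>2 - K\<^sup>2 - 5 \<le> 6 n\<close> and \<open>n \<le> (K + 1 + j)\<^sup>2 - K\<^sup>2 - 1\<close>, as each step is between \<open>1\<close> and
  \<open>6\<close>. It remains to see that \<open>j\<close> is nearly geometrically distributed: every new square is
  hit with conditional probability between \<open>2/7 - \<epsilon>\<close> and \<open>2/7 + \<epsilon>\<close>, where \<open>\<epsilon> = eps K\<close>.

  Let \<open>renewal n\<close> be the probability that the walk from \<open>0\<close> ever visits \<open>n\<close>. The key fact is the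
  exact formula \<open>renewal n = (2 + \<Sigma> r^n) / 7\<close>, with the sum over the five roots \<open>r \<noteq> 1\<close> of the
  characteristic polynomial (\<open>renewal_power_sum\<close>): both sides solve the same recurrence, and
  the initial values agree by Newton's identities. Since \<open>w_plus\<close> and its conjugate have the
  largest modulus among these roots (\<open>w_plus_spectrum\<close>), the triangle inequality gives
  \<open>\<bar>renewal n - 2/7\<bar> < 5/7 * cmod w_plus ^ n\<close> for \<open>n \<ge> 1\<close> (\<open>renewal_error\<close>).

  A walk that has jumped from below \<open>m\<^sup>2\<close> to \<open>m\<^sup>2 + k\<close> with \<open>k \<le> 5\<close> has a square-free distance
  \<open>2m + 1 - k \<ge> 2K - 4\<close> to the next square, so it hits that square with probability
  \<open>renewal (2m + 1 - k)\<close>. Averaging over \<open>k\<close> yields the conditional hitting probability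
  (\<open>reach_across_gap\<close>, \<open>hazard_error\<close>), and multiplying these along successive squares yields
  the geometric comparison (\<open>reach_square_geometric\<close>).

  The masses in this argument are defined by deterministic recurrences. Independence of the
  dice enters only through \<open>next_step_indep\<close>, by which \<open>prob_first_visit\<close> identifies these numbers
  as probabilities. In particular the mass crossing \<open>K\<^sup>2\<close> without a hit is the probability of
  the survival event.
\<close>

section \<open>The subdominant roots\<close>

text \<open>
  The polynomial \<open>6x^6 - x^5 - x^4 - x^3 - x^2 - x - 1\<close> divided by \<open>x - 1\<close>; its five roots
  govern how fast the die walk forgets its starting point.
\<close>
definition quintic :: "complex poly" where
  "quintic = [:1, 2, 3, 4, 5, 6:]"

text \<open>
  A polynomial is its leading coefficient times the product of the distances to its roots; if
  all of them were at least \<open>d\<close>, its value would be too large. So a small value locates a root.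
\<close>
lemma poly_root_near:
  fixes p :: "complex poly"
  assumes "p \<noteq> 0" and "cmod (poly p z) < cmod (lead_coeff p) * d ^ degree p" and "d \<ge> 0"
  obtains r where "poly p r = 0" "cmod (z - r) < d"
proof -
  obtain A where A: "size A = degree p" "p = smult (lead_coeff p) (\<Prod>x\<in>#A. [:-x, 1:])"
    using alg_closed_imp_factorization[OF assms(1)] by blast
  have pz: "poly p y = lead_coeff p * (\<Prod>x\<in>#A. y - x)" for y
    by (subst A(2)) (simp add: poly_prod_mset)
  have "\<exists>r\<in>#A. cmod (z - r) < d"
  proof (rule ccontr)
    assume "\<not> ?thesis"
    hence far: "d \<le> cmod (z - r)" if "r \<in># A" for r
      using that by force
    have "B \<subseteq># A \<Longrightarrow> d ^ size B \<le> cmod (\<Prod>x\<in>#B. z - x)" for B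
    proof (induction B)
      case (add x B)
      hence "x \<in># A" "d ^ size B \<le> cmod (\<Prod>x\<in>#B. z - x)"
        by (auto dest: subset_mset.order_trans[rotated] mset_subset_eq_insertD)
      thus ?case using far[of x] \<open>d \<ge> 0\<close> by (simp add: norm_mult mult_mono)
    qed simp
    from this[of A] show False
      using assms(2) A(1) pz[of z] by (simp add: norm_mult mult_le_cancel_left_pos not_less)
        (metis \<open>p \<noteq> 0\<close> leading_coeff_neq_0 linorder_not_less mult_le_cancel_left_pos zero_less_norm_iff)
  qed
  then obtain r where "r \<in># A" "cmod (z - r) < d" by blast
  moreover from this have "poly p r = 0"
    by (auto simp: pz prod_mset_zero_iff)
  ultimately show thesis using that by blast
qed

lemma quintic_root_near:
  fixes a b :: real
  defines "z \<equiv> Complex a b"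
  assumes "(cmod (poly quintic z))\<^sup>2 < 36 / 80 ^ 10"
  obtains r where "poly quintic r = 0" "\<bar>a - Re r\<bar> < 1/80" "\<bar>b - Im r\<bar> < 1/80"
proof -
  have "cmod (poly quintic z) < 6 / 80 ^ 5"
    by (rule power2_less_imp_less) (use assms(2) in \<open>simp_all add: power_divide\<close>)
  hence "cmod (poly quintic z) < cmod (lead_coeff quintic) * (1/80) ^ degree quintic"
    by (simp add: quintic_def power_divide del: poly_pCons)
  then obtain r where r: "poly quintic r = 0" "cmod (z - r) < 1/80"
    using poly_root_near[of quintic z "1/80"] by (auto simp: quintic_def)
  moreover have "\<bar>Re z - Re r\<bar> \<le> cmod (z - r)" "\<bar>Im z - Im r\<bar> \<le> cmod (z - r)"
    using abs_Re_le_cmod[of "z - r"] abs_Im_le_cmod[of "z - r"] by auto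
  ultimately show thesis using that[of r] by (simp add: z_def)
qed

lemma poly_quintic_cnj: "poly quintic z = 0 \<Longrightarrow> poly quintic (cnj z) = 0"
proof -
  have "poly quintic (cnj z) = cnj (poly quintic z)" by (simp add: quintic_def)
  thus "poly quintic z = 0 \<Longrightarrow> poly quintic (cnj z) = 0" by simp
qed

lemma poly_eq_prod_linear_factors:
  fixes p :: "'a::alg_closed_field poly"
  assumes "p \<noteq> 0" "\<And>x. x \<in> S \<Longrightarrow> poly p x = 0" "finite S" "card S = degree p"
  shows "p = smult (lead_coeff p) (\<Prod>x\<in>S. [:-x, 1:])"
proof -
  obtain A where A: "size A = degree p" "p = smult (lead_coeff p) (\<Prod>x\<in>#A. [:-x, 1:])"
    using alg_closed_imp_factorization[OF assms(1)] by blast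
  have "x \<in># A" if "x \<in> S" for x
  proof -
    have "poly p x = lead_coeff p * (\<Prod>y\<in>#A. x - y)"
      by (subst A(2)) (simp add: poly_prod_mset)
    thus ?thesis using assms(1) assms(2)[OF that] by (auto simp: prod_mset_zero_iff)
  qed
  hence "mset_set S \<subseteq># A"
    using assms(3) by (metis finite_set_mset_mset_set msubset_mset_set_iff mset_subset_eqI subset_iff finite_set_mset count_mset_set count_greater_eq_one_iff less_eq_nat.simps(1))
  hence "mset_set S = A"
    using A(1) assms(4) mset_subset_size[of "mset_set S" A] by (auto simp: subset_mset.le_less)
  thus ?thesis using A(2) by (simp add: prod_unfold_prod_mset)
qed

text \<open>
  The decimals of the five roots, fed into \<open>quintic_root_near\<close>, put a root into each of five
  disjoint boxes, so these are all roots and they are simple. For a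
  box of radius \<open>1/80\<close> the value at the centre has to be below \<open>6 / 80 ^ 5\<close>, which ten decimals achieve.
\<close>
lemma quintic_roots:
  obtains u v w where
    "quintic = smult 6 ([:-u, 1:] * [:-v, 1:] * [:-cnj v, 1:] * [:-w, 1:] * [:-cnj w, 1:])"
    "-683/1000 < Re u" "Re u < -657/1000" "-13/1000 < Im u" "Im u < 13/1000"
    "-389/1000 < Re v" "Re v < -363/1000" "557/1000 < Im v" "Im v < 583/1000"
    "281/1000 < Re w" "Re w < 307/1000" "655/1000 < Im w" "Im w < 681/1000"
proof -
  have "(cmod (poly quintic (Complex (-6703320476 / 10000000000) (0))))\<^sup>2 < 36 / 80 ^ 10"
    by (simp only: cmod_power2) (simp add: quintic_def power2_eq_square)
  then obtain u where u: "poly quintic u = 0" "\<bar>-6703320476 / 10000000000 - Re u\<bar> < 1/80" "\<bar>0 - Im u\<bar> < 1/80"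
    by (rule quintic_root_near)
  have "(cmod (poly quintic (Complex (-3756951992 / 10000000000) (5701751610 / 10000000000))))\<^sup>2 < 36 / 80 ^ 10"
    by (simp only: cmod_power2) (simp add: quintic_def power2_eq_square)
  then obtain v where v: "poly quintic v = 0" "\<bar>-3756951992 / 10000000000 - Re v\<bar> < 1/80" "\<bar>5701751610 / 10000000000 - Im v\<bar> < 1/80"
    by (rule quintic_root_near)
  have "(cmod (poly quintic (Complex (2941945564 / 10000000000) (6683670974 / 10000000000))))\<^sup>2 < 36 / 80 ^ 10"
    by (simp only: cmod_power2) (simp add: quintic_def power2_eq_square)
  then obtain w where w: "poly quintic w = 0" "\<bar>2941945564 / 10000000000 - Re w\<bar> < 1/80" "\<bar>6683670974 / 10000000000 - Im w\<bar> < 1/80"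
    by (rule quintic_root_near)
  have signs: "Re u < -1/2" "-1/2 < Re v" "Re v < 0" "0 < Re w" "0 < Im v" "0 < Im w"
    using u(2,3) v(2,3) w(2,3) unfolding abs_less_iff by linarith+
  have dist: "u \<noteq> v" "u \<noteq> cnj v" "u \<noteq> w" "u \<noteq> cnj w" "v \<noteq> cnj v" "v \<noteq> w" "v \<noteq> cnj w"
    "cnj v \<noteq> w" "cnj v \<noteq> cnj w" "w \<noteq> cnj w"
    using signs by (auto simp: complex_eq_iff)
  have "quintic = smult (lead_coeff quintic) (\<Prod>x\<in>{u, v, cnj v, w, cnj w}. [:-x, 1:])"
    by (rule poly_eq_prod_linear_factors)
       (use u(1) v(1) w(1) poly_quintic_cnj dist in \<open>auto simp: quintic_def\<close>)
  also have "(\<Prod>x\<in>{u, v, cnj v, w, cnj w}. [:-x, 1:]) = 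
      [:-u, 1:] * [:-v, 1:] * [:-cnj v, 1:] * [:-w, 1:] * [:-cnj w, 1:]"
    using dist by (simp add: mult.assoc del: mult_pCons_left mult_pCons_right)
  also have "lead_coeff quintic = 6" by (simp add: quintic_def)
  finally show thesis
    by (rule that) (use u(2,3) v(2,3) w(2,3) in \<open>unfold abs_less_iff, linarith\<close>)+
qed

lemma quintic_times_linear: "[:-1, -1, -1, -1, -1, -1, 6:] = [:-1, 1:] * quintic"
  by (simp add: quintic_def)

text \<open>
  Evaluating the product factor by factor keeps the simplifier from expanding it into
  coefficients.
\<close>
lemma poly_five_linear_factors:
  fixes a b c d e :: "'a::comm_ring_1"
  shows "poly (smult k ([:-a, 1:] * [:-b, 1:] * [:-c, 1:] * [:-d, 1:] * [:-e, 1:])) z =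
    k * ((z - a) * (z - b) * (z - c) * (z - d) * (z - e))"
  by (simp only: poly_smult poly_mult) simp

text \<open>
  Newton's identities, written out for the power sums of the roots of the quintic. The numbers
  are \<open>7 * renewal n - 2\<close> for \<open>n = 0, \<dots>, 4\<close>, which is what \<open>renewal_power_sum\<close> compares them with.
\<close>
lemma quintic_power_sums:
  fixes u v v' w w' :: complex
  assumes Q: "quintic = smult 6 ([:-u, 1:] * [:-v, 1:] * [:-v', 1:] * [:-w, 1:] * [:-w', 1:])"
  defines "s \<equiv> \<lambda>n. u ^ n + v ^ n + v' ^ n + w ^ n + w' ^ n"
  shows "s 0 = 5" "s 1 = -5/6" "s 2 = -23/36" "s 3 = -89/216" "s 4 = -191/1296"
    "6 * s (n + 5) + 5 * s (n + 4) + 4 * s (n + 3) + 3 * s (n + 2) + 2 * s (n + 1) + s n = 0"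
proof -
  define e1 where "e1 = u + v + v' + w + w'"
  define e2 where "e2 = u * v + u * v' + u * w + u * w' + v * v' + v * w + v * w' + v' * w + v' * w' + w * w'"
  define e3 where "e3 = u * v * v' + u * v * w + u * v * w' + u * v' * w + u * v' * w' + u * w * w' + v * v' * w + v * v' * w' + v * w * w' + v' * w * w'"
  define e4 where "e4 = u * v * v' * w + u * v * v' * w' + u * v * w * w' + u * v' * w * w' + v * v' * w * w'"
  have "[:-u, 1:] * [:-v, 1:] * [:-v', 1:] * [:-w, 1:] * [:-w', 1:] = [:-(u * v * v' * w * w'), e4, -e3, e2, -e1, 1:]"
    by (simp add: e1_def e2_def e3_def e4_def algebra_simps)
  with Q have "quintic = smult 6 [:-(u * v * v' * w * w'), e4, -e3, e2, -e1, 1:]"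
    by (simp only:)
  hence "6 * e1 = -5" "6 * e2 = 4" "6 * e3 = -3" "6 * e4 = 2"
    by (simp_all add: quintic_def minus_equation_iff)
  hence e: "e1 = -5/6" "e2 = 4/6" "e3 = -3/6" "e4 = 2/6"
    by (simp_all add: field_simps)
  show "s 0 = 5" by (simp add: s_def)
  show s1: "s 1 = -5/6" using e(1) by (simp add: s_def e1_def)
  have "s 2 = e1 * s 1 - 2 * e2"
    by (simp add: s_def e1_def e2_def power2_eq_square algebra_simps)
  thus s2: "s 2 = -23/36" by (simp only: s1 e) simp
  have "s 3 = e1 * s 2 - e2 * s 1 + 3 * e3"
    by (simp add: s_def e1_def e2_def e3_def power2_eq_square power3_eq_cube algebra_simps)
  thus s3: "s 3 = -89/216" by (simp only: s1 s2 e) simp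
  have "s 4 = e1 * s 3 - e2 * s 2 + e3 * s 1 - 4 * e4"
    by (simp add: s_def e1_def e2_def e3_def e4_def power2_eq_square power3_eq_cube power4_eq_xxxx algebra_simps)
  thus "s 4 = -191/1296" by (simp only: s1 s2 s3 e) simp
  have root: "6 * r^(n+5) + 5 * r^(n+4) + 4 * r^(n+3) + 3 * r^(n+2) + 2 * r^(n+1) + r^n = 0"
    if "r \<in> {u, v, v', w, w'}" for r
  proof -
    have "poly quintic r = 0" unfolding Q poly_five_linear_factors using that by auto
    hence "r^n * (1 + r * (2 + r * (3 + r * (4 + r * (5 + r * 6))))) = 0" by (simp add: quintic_def)
    thus ?thesis by (simp add: algebra_simps power_add eval_nat_numeral)
  qed
  have "6 * s (n + 5) + 5 * s (n + 4) + 4 * s (n + 3) + 3 * s (n + 2) + 2 * s (n + 1) + s n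
    = (\<Sum>r\<leftarrow>[u, v, v', w, w']. 6 * r^(n+5) + 5 * r^(n+4) + 4 * r^(n+3) + 3 * r^(n+2) + 2 * r^(n+1) + r^n)"
    by (simp add: s_def algebra_simps)
  also have "\<dots> = (\<Sum>r\<leftarrow>[u, v, v', w, w']. 0)"
    by (intro arg_cong[of _ _ sum_list] map_cong refl root) auto
  also have "\<dots> = 0" by simp
  finally show "6 * s (n + 5) + 5 * s (n + 4) + 4 * s (n + 3) + 3 * s (n + 2) + 2 * s (n + 1) + s n = 0" .
qed

text \<open>
  The boxes of \<open>quintic_roots\<close> are too coarse for the tolerance in the definition of \<open>w_plus\<close>. But
  they show that the other four roots stay away from the given centre \<open>c\<close>, so the value of the
  quintic at \<open>c\<close> bounds the distance from \<open>c\<close> to the remaining root linearly, which is sharp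
  enough. The boxes do suffice to compare the moduli.
\<close>
lemma w_plus_spectrum:
  obtains u v where
    "quintic = smult 6 ([:-u, 1:] * [:-v, 1:] * [:-cnj v, 1:] * [:-w_plus, 1:] * [:-cnj w_plus, 1:])"
    "cmod u < cmod w_plus" "cmod v < cmod w_plus" "0 < cmod w_plus" "cmod w_plus < 3/4"
proof -
  obtain u v w where Q: "quintic = smult 6 ([:-u, 1:] * [:-v, 1:] * [:-cnj v, 1:] * [:-w, 1:] * [:-cnj w, 1:])"
    and u: "-683/1000 < Re u" "Re u < -657/1000" "-13/1000 < Im u" "Im u < 13/1000"
    and v: "-389/1000 < Re v" "Re v < -363/1000" "557/1000 < Im v" "Im v < 583/1000"
    and w: "281/1000 < Re w" "Re w < 307/1000" "655/1000 < Im w" "Im w < 681/1000"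
    by (rule quintic_roots)
  define c where "c = Complex 0.2941945564 0.6683670974"
  have roots: "poly quintic z = 0 \<longleftrightarrow> z \<in> {u, v, cnj v, w, cnj w}" for z
    unfolding Q poly_five_linear_factors by auto
  \<comment> \<open>The four other roots, seen from the centre; six times the product of these distances exceeds \<open>1\<close>.\<close>
  have far: "cmod (c - u) \<ge> 0.9" "cmod (c - v) \<ge> 0.6" "cmod (c - cnj v) \<ge> 1.2" "cmod (c - cnj w) \<ge> 1.3"
  proof -
    have "0.9 \<le> Re (c - u)" "0.6 \<le> Re (c - v)" "1.2 \<le> Im (c - cnj v)" "1.3 \<le> Im (c - cnj w)"
      using u v w by (simp_all add: c_def)
    thus "cmod (c - u) \<ge> 0.9" "cmod (c - v) \<ge> 0.6" "cmod (c - cnj v) \<ge> 1.2" "cmod (c - cnj w) \<ge> 1.3"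
      by (meson order_trans complex_Re_le_cmod abs_ge_self abs_Im_le_cmod)+
  qed
  have near: "cmod (w - c) < 1 / 10 ^ 9"
  proof -
    have "(cmod (poly quintic c))\<^sup>2 < (1 / 10 ^ 9)\<^sup>2"
      unfolding cmod_power2 by (simp add: c_def quintic_def power2_eq_square)
    hence "cmod (poly quintic c) < 1 / 10 ^ 9"
      by (rule power2_less_imp_less) simp
    moreover have "cmod (poly quintic c) = cmod (w - c) * (6 * (cmod (c - u) * cmod (c - v) * cmod (c - cnj v) * cmod (c - cnj w)))"
      unfolding Q poly_five_linear_factors by (simp add: norm_mult norm_minus_commute)
    moreover have "0.9 * 0.6 * 1.2 * 1.3 \<le> cmod (c - u) * cmod (c - v) * cmod (c - cnj v) * cmod (c - cnj w)"
      by (intro mult_mono far) auto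
    hence "cmod (w - c) * 1 \<le> cmod (w - c) * (6 * (cmod (c - u) * cmod (c - v) * cmod (c - cnj v) * cmod (c - cnj w)))"
      by (intro mult_left_mono) auto
    ultimately show ?thesis by simp
  qed
  have "w_plus = w"
    unfolding w_plus_def quintic_times_linear c_def[symmetric]
  proof (rule the_equality)
    show "poly ([:-1, 1:] * quintic) w = 0 \<and> cmod (w - c) < 1 / 10 ^ 9"
      using near roots[of w] by simp
    fix z assume z: "poly ([:-1, 1:] * quintic) z = 0 \<and> cmod (z - c) < 1 / 10 ^ 9"
    hence "z = 1 \<or> z \<in> {u, v, cnj v, w, cnj w}" using roots[of z] by auto
    moreover have "cmod (c - z) < 0.1" using z by (simp add: norm_minus_commute)
    moreover have "cmod (c - 1) > 0.1"
      using abs_Re_le_cmod[of "c - 1"] by (simp add: c_def)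
    ultimately show "z = w" using far by auto
  qed
  have sq_le: "x\<^sup>2 \<le> b\<^sup>2" if "\<bar>x\<bar> \<le> b" for x b :: real
    using that abs_le_square_iff[of x b] by auto
  have sq_ge: "a\<^sup>2 \<le> x\<^sup>2" if "a \<le> x" "0 \<le> a" for x a :: real
    using that by (simp add: power_mono)
  have w2: "(cmod w)\<^sup>2 \<ge> (281/1000)\<^sup>2 + (655/1000)\<^sup>2" "(cmod w)\<^sup>2 \<le> (307/1000)\<^sup>2 + (681/1000)\<^sup>2"
    unfolding cmod_power2 by (intro add_mono sq_le sq_ge; use w in linarith)+
  have u2: "(cmod u)\<^sup>2 \<le> (683/1000)\<^sup>2 + (13/1000)\<^sup>2"
    unfolding cmod_power2 by (intro add_mono sq_le; use u in linarith)
  have v2: "(cmod v)\<^sup>2 \<le> (389/1000)\<^sup>2 + (583/1000)\<^sup>2"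
    unfolding cmod_power2 by (intro add_mono sq_le; use v in linarith)
  have "cmod u < cmod w"
    by (rule power2_less_imp_less, rule le_less_trans[OF u2 less_le_trans[OF _ w2(1)]])
       (simp_all add: power2_eq_square)
  moreover have "cmod v < cmod w"
    by (rule power2_less_imp_less, rule le_less_trans[OF v2 less_le_trans[OF _ w2(1)]])
       (simp_all add: power2_eq_square)
  moreover have "cmod w < 3/4"
    by (rule power2_less_imp_less, rule le_less_trans[OF w2(2)]) (simp_all add: power2_eq_square)
  ultimately show thesis
    using that Q \<open>w_plus = w\<close> by (smt (verit) norm_ge_zero)
qed

section \<open>Masses of a walk killed on a target set\<close>

text \<open>
  The probability that the walk from \<open>s\<close> is at \<open>y\<close> at time \<open>t\<close> and has avoided \<open>H\<close> strictly before
  \<open>t\<close>. Positions are integers so that \<open>y - d\<close> does not truncate; negative positions carry no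
  mass, which makes the value of \<open>nat\<close> there harmless.
\<close>
primrec visit_prob :: "nat set \<Rightarrow> nat \<Rightarrow> nat \<Rightarrow> int \<Rightarrow> real" where
  "visit_prob H s 0 y = of_bool (y = int s)"
| "visit_prob H s (Suc t) y =
     (\<Sum>d=1..6. of_bool (nat (y - int d) \<notin> H) * visit_prob H s t (y - int d)) / 6"

text \<open>
  The probability of ever visiting \<open>y\<close> with no earlier visit to \<open>H\<close>. The sum over times stops at
  \<open>y\<close> because every step is at least \<open>1\<close>.
\<close>
definition reach :: "nat set \<Rightarrow> nat \<Rightarrow> int \<Rightarrow> real" where
  "reach H s y = (\<Sum>t\<le>nat y. visit_prob H s t y)"

definition alive :: "nat set \<Rightarrow> nat \<Rightarrow> int \<Rightarrow> real" where
  "alive H s y = of_bool (nat y \<notin> H) * reach H s y"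

text \<open>
  The probability of jumping over level \<open>n\<close> without having visited \<open>H\<close>: from \<open>n - i\<close> this takes
  a throw larger than \<open>i\<close>, of probability \<open>(6 - i)/6\<close>.
\<close>
definition crossing_mass :: "nat set \<Rightarrow> nat \<Rightarrow> int \<Rightarrow> real" where
  "crossing_mass H s n = (\<Sum>i<6. (6 - real i) / 6 * alive H s (n - int i))"

text \<open>
  The part of the crossing mass at level \<open>a\<close> that lands exactly at \<open>a + k\<close>.
\<close>
definition overshoot :: "nat set \<Rightarrow> nat \<Rightarrow> int \<Rightarrow> nat \<Rightarrow> real" where
  "overshoot H s a k = (\<Sum>d=k..6. alive H s (a + int k - int d)) / 6"

abbreviation renewal :: "int \<Rightarrow> real" where
  "renewal \<equiv> reach {} 0"

lemma visit_prob_nonneg: "visit_prob H s t y \<ge> 0"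
  by (induction t arbitrary: y) (auto intro!: sum_nonneg divide_nonneg_nonneg)

lemma visit_prob_eq_0: "y < int s + int t \<Longrightarrow> visit_prob H s t y = 0"
  by (induction t arbitrary: y) (auto intro!: sum.neutral)

lemma reach_nonneg: "reach H s y \<ge> 0"
  unfolding reach_def by (intro sum_nonneg visit_prob_nonneg)

lemma alive_nonneg: "alive H s y \<ge> 0"
  unfolding alive_def by (simp add: reach_nonneg)

lemma reach_eq_sum: "nat y \<le> n \<Longrightarrow> reach H s y = (\<Sum>t\<le>n. visit_prob H s t y)"
  unfolding reach_def by (rule sum.mono_neutral_left) (auto intro!: visit_prob_eq_0)

lemma reach_eq_0: "y < int s \<Longrightarrow> reach H s y = 0"
  unfolding reach_def by (auto intro!: sum.neutral visit_prob_eq_0)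

lemma alive_eq_0: "y < int s \<Longrightarrow> alive H s y = 0"
  by (simp add: alive_def reach_eq_0)

lemma reach_recurrence:
  "reach H s y = of_bool (y = int s) + (\<Sum>d=1..6. alive H s (y - int d)) / 6"
proof -
  define n where "n = nat y"
  have "reach H s y = (\<Sum>t\<le>Suc n. visit_prob H s t y)"
    by (rule reach_eq_sum) (simp add: n_def)
  also have "\<dots> = of_bool (y = int s) + (\<Sum>t\<le>n. visit_prob H s (Suc t) y)"
    by (subst sum.atMost_Suc_shift) simp
  also have "(\<Sum>t\<le>n. visit_prob H s (Suc t) y) =
      (\<Sum>d=1..6. of_bool (nat (y - int d) \<notin> H) * (\<Sum>t\<le>n. visit_prob H s t (y - int d))) / 6"
    unfolding visit_prob.simps sum_divide_distrib[symmetric] sum_distrib_left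
    by (subst sum.swap) simp
  also have "\<dots> = (\<Sum>d=1..6. alive H s (y - int d)) / 6"
    unfolding alive_def by (intro arg_cong2[of _ _ _ _ "(/)"] sum.cong refl arg_cong2[of _ _ _ _ "(*)"] reach_eq_sum[symmetric])
      (auto simp: n_def)
  finally show ?thesis .
qed

text \<open>
  Mass is conserved from one level to the next, except for the mass entering at the start and
  the mass absorbed in \<open>H\<close>.
\<close>
lemma crossing_mass_step:
  "crossing_mass H s n = crossing_mass H s (n - 1) + of_bool (n = int s) - of_bool (nat n \<in> H) * reach H s n"
proof -
  have "crossing_mass H s n - crossing_mass H s (n - 1) = alive H s n - (\<Sum>d=1..6. alive H s (n - int d)) / 6"
    by (simp add: crossing_mass_def eval_nat_numeral field_simps)
  also have "\<dots> = alive H s n - (reach H s n - of_bool (n = int s))"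
    using reach_recurrence[of H s n] by simp
  also have "\<dots> = of_bool (n = int s) - of_bool (nat n \<in> H) * reach H s n"
    by (simp add: alive_def)
  finally show ?thesis by simp
qed

lemma crossing_mass_eq:
  "crossing_mass H s (int n) = of_bool (s \<le> n) - (\<Sum>y\<in>H \<inter> {..n}. reach H s (int y))"
proof (induction n)
  case 0
  have "crossing_mass H s (-1) = 0"
    unfolding crossing_mass_def by (intro sum.neutral) (auto simp: alive_eq_0)
  thus ?case using crossing_mass_step[of H s 0]
    by (auto simp: Int_insert_right)
next
  case (Suc n)
  have "H \<inter> {..Suc n} = (if Suc n \<in> H then insert (Suc n) (H \<inter> {..n}) else H \<inter> {..n})"
    by (auto simp: le_Suc_eq)
  thus ?case using Suc.IH crossing_mass_step[of H s "int (Suc n)"]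
    by (auto simp: nat_add_distrib)
qed

lemma sum_overshoot: "(\<Sum>k=1..6. overshoot H s a k) = crossing_mass H s a"
  by (simp add: overshoot_def crossing_mass_def eval_nat_numeral atLeastAtMostSuc_conv field_simps)

text \<open>
  Above \<open>a\<close>, and until the next point of \<open>H\<close>, nothing is killed, so the walk is a mixture of free
  walks started at the overshoot positions. Both sides satisfy the die recurrence with the same
  inhomogeneous term, which the induction compares.
\<close>
lemma reach_across_gap:
  assumes "int s \<le> a" "n \<ge> 1" "\<And>i. 1 \<le> i \<Longrightarrow> i < n \<Longrightarrow> nat (a + int i) \<notin> H"
  shows "reach H s (a + int n) = (\<Sum>k=1..6. overshoot H s a k * renewal (int n - int k))"
  using assms(2,3)
proof (induction n rule: less_induct)
  case (less n)
  \<comment> \<open>For \<open>d < n\<close> the position lies inside the gap and the induction hypothesis applies; for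
    \<open>n \<le> d\<close> it is at or below \<open>a\<close>, and the convolution vanishes since \<open>renewal\<close> does on negative numbers.\<close>
  have prev: "alive H s (a + int n - int d) = of_bool (n \<le> d) * alive H s (a + int n - int d)
      + (\<Sum>k=1..6. overshoot H s a k * renewal (int n - int d - int k))" if "d \<in> {1..6}" for d
  proof (cases "n \<le> d")
    case True
    thus ?thesis using that by (simp add: reach_eq_0)
  next
    case False
    hence "alive H s (a + int (n - d)) = reach H s (a + int (n - d))"
      using less.prems(2)[of "n - d"] that by (simp add: alive_def)
    also have "\<dots> = (\<Sum>k=1..6. overshoot H s a k * renewal (int (n - d) - int k))"
      by (rule less.IH) (use False that less.prems(2) in auto)
    finally show ?thesis using False by (simp add: of_nat_diff algebra_simps)
  qed
  have over: "(\<Sum>d=1..6. of_bool (n \<le> d) * alive H s (a + int n - int d)) / 6 =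
      (\<Sum>k=1..6. overshoot H s a k * of_bool (n = k))"
  proof -
    have "(\<Sum>d=1..6. of_bool (n \<le> d) * alive H s (a + int n - int d)) = (\<Sum>d=n..6. alive H s (a + int n - int d))"
      using less.prems(1) by (intro sum.mono_neutral_cong_right) auto
    moreover have "(\<Sum>k=1..6. overshoot H s a k * of_bool (n = k)) = (if n \<le> 6 then overshoot H s a n else 0)"
      using less.prems(1) by (simp add: of_bool_def if_distrib sum.delta' cong: if_cong)
    ultimately show ?thesis by (auto simp: overshoot_def)
  qed
  have ren: "(\<Sum>d=1..6. renewal (int n - int d - int k)) / 6 = renewal (int n - int k) - of_bool (n = k)" for k
    using reach_recurrence[of "{}" 0 "int n - int k"] by (simp add: alive_def algebra_simps)
  have "reach H s (a + int n) = (\<Sum>d=1..6. alive H s (a + int n - int d)) / 6"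
    using reach_recurrence[of H s "a + int n"] assms(1) less.prems(1) by simp
  also have "\<dots> = (\<Sum>d=1..6. of_bool (n \<le> d) * alive H s (a + int n - int d)) / 6
      + (\<Sum>d=1..6. \<Sum>k=1..6. overshoot H s a k * renewal (int n - int d - int k)) / 6"
    by (subst sum.cong[OF refl prev]) (simp_all add: sum.distrib add_divide_distrib)
  also have "(\<Sum>d=1..6. \<Sum>k=1..6. overshoot H s a k * renewal (int n - int d - int k)) / 6
      = (\<Sum>k=1..6. overshoot H s a k * ((\<Sum>d=1..6. renewal (int n - int d - int k)) / 6))"
    by (subst sum.swap) (simp add: sum_distrib_left sum_divide_distrib)
  also have "\<dots> = (\<Sum>k=1..6. overshoot H s a k * renewal (int n - int k)) - (\<Sum>k=1..6. overshoot H s a k * of_bool (n = k))"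
    by (simp only: ren right_diff_distrib sum_subtractf)
  finally show ?case by (simp only: over)
qed

section \<open>The conditional probability of hitting the next square\<close>

text \<open>
  Conservation of mass for the free walk says \<open>\<Sigma> (6 - i) renewal (n - i) = 6\<close>. This is a
  recurrence of order five whose characteristic polynomial is the quintic, with constant solution
  \<open>2/7\<close> since \<open>6 + 5 + 4 + 3 + 2 + 1 = 21\<close>.
\<close>
lemma renewal_power_sum:
  fixes u v v' w w' :: complex
  assumes Q: "quintic = smult 6 ([:-u, 1:] * [:-v, 1:] * [:-v', 1:] * [:-w, 1:] * [:-w', 1:])"
  shows "of_real (renewal (int n)) = (2 + (u ^ n + v ^ n + v' ^ n + w ^ n + w' ^ n)) / 7"
proof -
  define p where "p = (\<lambda>n::int. renewal n)"
  define s where "s = (\<lambda>n. u ^ n + v ^ n + v' ^ n + w ^ n + w' ^ n)"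
  have ps: "s 0 = 5" "s (Suc 0) = -5/6" "s 2 = -23/36" "s 3 = -89/216" "s 4 = -191/1296"
    using quintic_power_sums(1-5)[OF Q] by (simp_all add: s_def)
  have s_rec: "6 * s (n + 5) + 5 * s (n + 4) + 4 * s (n + 3) + 3 * s (n + 2) + 2 * s (n + 1) + s n = 0" for n
    unfolding s_def by (rule quintic_power_sums(6)[OF Q])
  have neg: "p i = 0" if "i < 0" for i
    using that by (simp add: p_def reach_eq_0)
  have rec: "6 * p (int n) + 5 * p (int n - 1) + 4 * p (int n - 2) + 3 * p (int n - 3) + 2 * p (int n - 4) + p (int n - 5) = 6" for n
  proof -
    have "crossing_mass {} 0 (int n) = 1" by (simp add: crossing_mass_eq)
    thus ?thesis by (simp add: crossing_mass_def alive_def p_def eval_nat_numeral)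
  qed
  have p0: "p 0 = 1" using rec[of 0] by (simp add: neg)
  have p1: "p 1 = 1/6" using rec[of 1] by (simp add: neg p0)
  have p2: "p 2 = 7/36" using rec[of 2] by (simp add: neg p0 p1)
  have p3: "p 3 = 49/216" using rec[of 3] by (simp add: neg p0 p1 p2)
  have p4: "p 4 = 343/1296" using rec[of 4] by (simp add: neg p0 p1 p2 p3)
  have "of_real (p (int n)) = (2 + s n) / 7"
  proof (induction n rule: less_induct)
    case (less n)
    show ?case
    proof (cases "n < 5")
      case True
      hence "n \<in> {0, 1, 2, 3, 4}" by auto
      thus ?thesis by (auto simp: ps p0 p1 p2 p3 p4)
    next
      case False
      then obtain k where k: "n = k + 5" by (metis add.commute le_Suc_ex not_less)
      have shift: "int n - 1 = int (k + 4)" "int n - 2 = int (k + 3)" "int n - 3 = int (k + 2)"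
        "int n - 4 = int (k + 1)" "int n - 5 = int k"
        using k by auto
      have IH: "of_real (p (int m)) = (2 + s m) / 7" if "m < n" for m
        using less.IH that by blast
      have "complex_of_real (6 * p (int n) + 5 * p (int (k + 4)) + 4 * p (int (k + 3))
          + 3 * p (int (k + 2)) + 2 * p (int (k + 1)) + p (int k)) = of_real 6"
        using rec[of n] unfolding shift by (simp only:)
      hence "6 * of_real (p (int n)) + 5 * ((2 + s (k + 4)) / 7) + 4 * ((2 + s (k + 3)) / 7)
          + 3 * ((2 + s (k + 2)) / 7) + 2 * ((2 + s (k + 1)) / 7) + (2 + s k) / 7 = 6"
        using k by (simp only: of_real_add of_real_mult of_real_numeral IH)
      moreover have "6 * (of_real (p (int n)) - (2 + s n) / 7)
          + (6 * s (k + 5) + 5 * s (k + 4) + 4 * s (k + 3) + 3 * s (k + 2) + 2 * s (k + 1) + s k) / 7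
        = 6 * of_real (p (int n)) + 5 * ((2 + s (k + 4)) / 7) + 4 * ((2 + s (k + 3)) / 7)
          + 3 * ((2 + s (k + 2)) / 7) + 2 * ((2 + s (k + 1)) / 7) + (2 + s k) / 7 - 6"
        by (simp only: k) (simp add: field_simps)
      ultimately have "6 * (of_real (p (int n)) - (2 + s n) / 7) = 0"
        by (simp only: s_rec) simp
      thus ?thesis by (simp only: mult_eq_0_iff eq_iff_diff_eq_0[symmetric]) simp
    qed
  qed
  thus ?thesis by (simp add: p_def s_def)
qed

lemma renewal_error:
  assumes "n \<ge> 1"
  shows "\<bar>renewal (int n) - 2 / 7\<bar> < 5 / 7 * cmod w_plus ^ n"
proof -
  obtain u v where Q: "quintic = smult 6 ([:-u, 1:] * [:-v, 1:] * [:-cnj v, 1:] * [:-w_plus, 1:] * [:-cnj w_plus, 1:])"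
    and less: "cmod u < cmod w_plus" "cmod v < cmod w_plus"
    by (rule w_plus_spectrum)
  have "complex_of_real (renewal (int n) - 2 / 7) = (u ^ n + v ^ n + cnj v ^ n + w_plus ^ n + cnj w_plus ^ n) / 7"
    using renewal_power_sum[OF Q, of n] by (simp add: field_simps)
  hence "\<bar>renewal (int n) - 2 / 7\<bar> = cmod ((u ^ n + v ^ n + cnj v ^ n + w_plus ^ n + cnj w_plus ^ n) / 7)"
    by (metis norm_of_real real_norm_def)
  also have "\<dots> \<le> (cmod u ^ n + cmod v ^ n + cmod v ^ n + cmod w_plus ^ n + cmod w_plus ^ n) / 7"
    unfolding norm_divide norm_numeral by (intro divide_right_mono norm_triangle_mono; simp add: norm_power)
  also have "\<dots> < 5 / 7 * cmod w_plus ^ n"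
    using power_strict_mono[OF less(1), of n] power_strict_mono[OF less(2), of n] assms by simp
  finally show ?thesis .
qed

lemma eps_pos: "eps K > 0"
  using w_plus_spectrum unfolding eps_def by (metis mult_pos_pos zero_less_power zero_less_divide_iff zero_less_numeral)

text \<open>
  Beyond this threshold the lower comparison probability \<open>2/7 - eps K\<close> would turn negative and the
  upper ratio \<open>5/7 + eps K\<close> would reach \<open>1\<close>.
\<close>
lemma eps_less: "K \<ge> 4 \<Longrightarrow> eps K < 2 / 7"
proof -
  assume "K \<ge> 4"
  obtain "0 < cmod w_plus" "cmod w_plus < 3 / 4" using w_plus_spectrum by metis
  hence "cmod w_plus ^ (2 * K - 4) \<le> cmod w_plus ^ 4"
    using \<open>K \<ge> 4\<close> by (intro power_decreasing) auto
  also have "\<dots> \<le> (3 / 4) ^ 4"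
    using \<open>0 < cmod w_plus\<close> \<open>cmod w_plus < 3 / 4\<close> by (intro power_mono) auto
  finally show ?thesis by (simp add: eps_def power4_eq_xxxx)
qed

abbreviation survivor_mass :: "nat \<Rightarrow> nat \<Rightarrow> real" where
  "survivor_mass s m \<equiv> crossing_mass squares s (int (m\<^sup>2))"

lemma between_squares:
  assumes "m\<^sup>2 < y" "y < (m + 1)\<^sup>2"
  shows "y \<notin> squares"
proof
  assume "y \<in> squares"
  then obtain j where "y = j\<^sup>2" by (auto simp: squares_def)
  with assms show False using power_less_imp_less_base[of m 2 j] power_less_imp_less_base[of j 2 "m + 1"] by simp
qed

lemma survivor_mass_Suc:
  assumes "s \<le> m\<^sup>2"
  shows "survivor_mass s (m + 1) = survivor_mass s m - reach squares s (int ((m + 1)\<^sup>2))"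
proof -
  have "squares \<inter> {..(m + 1)\<^sup>2} = insert ((m + 1)\<^sup>2) (squares \<inter> {..m\<^sup>2})"
  proof -
    have "y \<le> m\<^sup>2" if "y \<in> squares" "y \<le> (m + 1)\<^sup>2" "y \<noteq> (m + 1)\<^sup>2" for y
      using between_squares[of m y] that by force
    moreover have "(m + 1)\<^sup>2 \<in> squares" unfolding squares_def by force
    moreover have "m\<^sup>2 \<le> (m + 1)\<^sup>2" by (intro power_mono) auto
    ultimately show ?thesis by (auto intro: order_trans)
  qed
  moreover have "(m + 1)\<^sup>2 \<notin> {..m\<^sup>2}" by (simp add: power2_eq_square)
  moreover have "s \<le> (m + 1)\<^sup>2" using assms by (simp add: power2_eq_square)
  ultimately show ?thesis using assms unfolding crossing_mass_eq by simp
qed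

text \<open>
  The walk cannot overshoot \<open>m\<^sup>2\<close> by \<open>6\<close>, since that jump would start from \<open>m\<^sup>2\<close>. Hence the distance
  \<open>2m + 1 - k\<close> to the next square is at least \<open>2K - 4\<close>, the exponent in \<open>eps K\<close>.
\<close>
lemma hazard_error:
  assumes "K \<ge> 4" "K \<le> m" "s \<le> m\<^sup>2" "survivor_mass s m > 0"
  shows "\<bar>reach squares s (int ((m + 1)\<^sup>2)) - 2 / 7 * survivor_mass s m\<bar> < eps K * survivor_mass s m"
proof -
  define a where "a = int (m\<^sup>2)"
  define e where "e = overshoot squares s a"
  have "a + int (2 * m + 1) = int ((m + 1)\<^sup>2)" by (simp add: a_def power2_eq_square)
  moreover have "nat (a + int i) \<notin> squares" if "1 \<le> i" "i < 2 * m + 1" for i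
  proof -
    have "nat (a + int i) = m\<^sup>2 + i" by (simp only: a_def of_nat_add[symmetric] nat_int)
    thus ?thesis using that by (intro between_squares[of m]) (auto simp: power2_eq_square)
  qed
  ultimately have "reach squares s (int ((m + 1)\<^sup>2)) = (\<Sum>k=1..6. e k * renewal (int (2 * m + 1) - int k))"
    using reach_across_gap[of s a "2 * m + 1" squares] assms(3) by (simp add: a_def e_def)
  moreover have mass: "survivor_mass s m = (\<Sum>k=1..6. e k)"
    unfolding e_def a_def by (rule sum_overshoot[symmetric])
  ultimately have diff: "reach squares s (int ((m + 1)\<^sup>2)) - 2 / 7 * survivor_mass s m =
      (\<Sum>k=1..6. e k * (renewal (int (2 * m + 1) - int k) - 2 / 7))"
    by (simp add: right_diff_distrib sum_subtractf sum_distrib_left mult.commute)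
  have e_nonneg: "e k \<ge> 0" for k
    unfolding e_def overshoot_def by (auto intro!: sum_nonneg divide_nonneg_nonneg alive_nonneg)
  have "m\<^sup>2 \<in> squares" using assms(1,2) by (auto simp: squares_def intro!: exI[of _ m])
  \<comment> \<open>An overshoot by \<open>6\<close> starts at the killed position \<open>m\<^sup>2\<close>.\<close>
  hence e6: "e 6 = 0" by (simp add: e_def overshoot_def alive_def a_def nat_power_eq)
  have err: "\<bar>renewal (int (2 * m + 1) - int k) - 2 / 7\<bar> < eps K" if "k \<in> {1..6}" "k \<noteq> 6" for k
  proof -
    have "\<bar>renewal (int (2 * m + 1 - k)) - 2 / 7\<bar> < 5 / 7 * cmod w_plus ^ (2 * m + 1 - k)"
      by (rule renewal_error) (use that assms in auto)
    also have "\<dots> \<le> eps K"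
    proof -
      have "0 < cmod w_plus" "cmod w_plus < 3 / 4" using w_plus_spectrum by metis+
      thus ?thesis unfolding eps_def using that assms
        by (intro mult_left_mono power_decreasing) auto
    qed
    finally show ?thesis using that assms by (simp add: of_nat_diff)
  qed
  have "\<exists>k\<in>{1..6}. e k \<noteq> 0"
    using assms(4) unfolding mass by (metis less_irrefl sum.neutral)
  then obtain k0 where k0: "k0 \<in> {1..6}" "e k0 \<noteq> 0" "k0 \<noteq> 6" using e6 by metis
  have "\<bar>\<Sum>k=1..6. e k * (renewal (int (2 * m + 1) - int k) - 2 / 7)\<bar>
      \<le> (\<Sum>k=1..6. e k * \<bar>renewal (int (2 * m + 1) - int k) - 2 / 7\<bar>)"
    by (rule order_trans[OF sum_abs]) (simp add: abs_mult e_nonneg)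
  also have "\<dots> < (\<Sum>k=1..6. e k * eps K)"
  proof (rule sum_strict_mono_ex1)
    show "\<forall>k\<in>{1..6}. e k * \<bar>renewal (int (2 * m + 1) - int k) - 2 / 7\<bar> \<le> e k * eps K"
    proof
      fix k :: nat assume "k \<in> {1..6}"
      thus "e k * \<bar>renewal (int (2 * m + 1) - int k) - 2 / 7\<bar> \<le> e k * eps K"
        using err[of k] e6 e_nonneg[of k] by (cases "k = 6") (auto intro!: mult_left_mono)
    qed
    show "\<exists>k\<in>{1..6}. e k * \<bar>renewal (int (2 * m + 1) - int k) - 2 / 7\<bar> < e k * eps K"
      using k0 err[of k0] e_nonneg[of k0] by (intro bexI[of _ k0] mult_strict_left_mono) auto
  qed simp
  also have "(\<Sum>k=1..6. e k * eps K) = eps K * survivor_mass s m"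
    unfolding mass sum_distrib_left by (simp only: mult.commute)
  finally show ?thesis unfolding diff .
qed

section \<open>The law of the killed walk\<close>

lemma walk_0 [simp]: "walk X s 0 x = s"
  by (simp add: walk_def)

lemma walk_Suc: "walk X s (Suc t) x = walk X s t x + X (Suc t) x"
  by (simp add: walk_def)

text \<open>
  Applied to the coordinate projections, \<open>walk\<close> turns a history of throws into a position. This
  exhibits events about the first \<open>t\<close> positions as events about the first \<open>t\<close> throws.
\<close>
lemma walk_restrict:
  "i \<le> t \<Longrightarrow> walk (\<lambda>i f. f i) s i (restrict (\<lambda>i. X i x) {1..t}) = walk X s i x"
  unfolding walk_def by (auto intro!: sum.cong)

context
  fixes M :: "'a measure" and X :: "nat \<Rightarrow> 'a \<Rightarrow> nat"
  assumes iid: "iid_dice M X"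
begin

interpretation prob_space M
  using iid by (simp add: iid_dice_def)

lemma dice_indep: "indep_vars (\<lambda>_. count_space UNIV) X {1..}"
  using iid by (simp add: iid_dice_def)

lemma dice_measurable: "i \<ge> 1 \<Longrightarrow> X i \<in> measurable M (count_space UNIV)"
  using dice_indep by (auto simp: indep_vars_def)

lemma dice_prob:
  assumes "i \<ge> 1" "d \<in> {1..6}"
  shows "prob {x \<in> space M. X i x = d} = 1 / 6"
proof -
  have "prob {x \<in> space M. X i x = d} = measure (distr M (count_space UNIV) (X i)) {d}"
    using dice_measurable[OF assms(1)] by (subst measure_distr) (auto intro!: arg_cong[of _ _ prob])
  also have "\<dots> = measure (measure_pmf (pmf_of_set {1..6})) {d}"
    using iid assms(1) by (simp add: iid_dice_def)
  also have "\<dots> = 1 / 6"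
    using assms(2) by (simp add: measure_pmf_single)
  finally show ?thesis .
qed

lemma AE_dice: "AE x in M. \<forall>i\<ge>1. X i x \<in> {1..6}"
proof -
  have "AE x in M. i \<ge> 1 \<longrightarrow> X i x \<in> {1..6}" for i
  proof (cases "i \<ge> 1")
    case True
    have "AE d in measure_pmf (pmf_of_set {1..6}). d \<in> {1..6::nat}"
      by (simp add: AE_measure_pmf_iff)
    moreover have "distr M (count_space UNIV) (X i) = measure_pmf (pmf_of_set {1..6})"
      using iid True by (simp add: iid_dice_def)
    ultimately have "AE d in distr M (count_space UNIV) (X i). d \<in> {1..6}" by (simp only:)
    thus ?thesis
      using AE_distrD[OF dice_measurable[OF True]] by auto
  qed simp
  thus ?thesis by (simp add: AE_all_countable)
qed

lemma history_measurable:
  "(\<lambda>x. restrict (\<lambda>i. X i x) {1..t}) \<in> measurable M (count_space (PiE {1..t} (\<lambda>_. UNIV)))"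
proof -
  have "(\<lambda>x. restrict (\<lambda>i. X i x) {1..t}) \<in> measurable M (PiM {1..t} (\<lambda>_. count_space UNIV))"
    by (intro measurable_restrict dice_measurable) auto
  thus ?thesis by (simp add: count_space_PiM_finite)
qed

lemma history_event: "{x \<in> space M. P (restrict (\<lambda>i. X i x) {1..t})} \<in> events"
proof -
  have "(\<lambda>x. restrict (\<lambda>i. X i x) {1..t}) -` {f \<in> PiE {1..t} (\<lambda>_. UNIV). P f} \<inter> space M \<in> events"
    by (rule measurable_sets[OF history_measurable]) auto
  also have "(\<lambda>x. restrict (\<lambda>i. X i x) {1..t}) -` {f \<in> PiE {1..t} (\<lambda>_. UNIV). P f} \<inter> space M
      = {x \<in> space M. P (restrict (\<lambda>i. X i x) {1..t})}" by auto
  finally show ?thesis .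
qed

text \<open>
  The only use of independence: a new throw is independent of any event about the past. On a
  finite product of countable discrete spaces every set of histories is measurable, so \<open>P\<close> is
  arbitrary.
\<close>
lemma next_step_indep:
  assumes "d \<in> {1..6}"
  shows "prob {x \<in> space M. P (restrict (\<lambda>i. X i x) {1..t}) \<and> X (Suc t) x = d} =
    prob {x \<in> space M. P (restrict (\<lambda>i. X i x) {1..t})} / 6"
proof -
  define past where "past = (\<lambda>x. restrict (\<lambda>i. X i x) {1..t})"
  define fut where "fut = (\<lambda>x. restrict (\<lambda>i. X i x) {Suc t})"
  define A where "A = {f \<in> PiE {1..t} (\<lambda>_. UNIV :: nat set). P f}"
  define B where "B = {f \<in> PiE {Suc t} (\<lambda>_. UNIV :: nat set). f (Suc t) = d}"
  have "indep_var (PiM {1..t} (\<lambda>_. count_space UNIV)) past (PiM {Suc t} (\<lambda>_. count_space UNIV)) fut"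
    unfolding past_def fut_def by (rule indep_var_restrict[OF dice_indep]) auto
  hence "prob ((\<lambda>x. (past x, fut x)) -` (A \<times> B) \<inter> space M) =
      prob (past -` A \<inter> space M) * prob (fut -` B \<inter> space M)"
    by (rule indep_varD) (simp_all add: count_space_PiM_finite A_def B_def)
  moreover have "(\<lambda>x. (past x, fut x)) -` (A \<times> B) \<inter> space M =
      {x \<in> space M. P (restrict (\<lambda>i. X i x) {1..t}) \<and> X (Suc t) x = d}"
    by (auto simp: past_def fut_def A_def B_def)
  moreover have "past -` A \<inter> space M = {x \<in> space M. P (restrict (\<lambda>i. X i x) {1..t})}"
    by (auto simp: past_def A_def)
  moreover have "fut -` B \<inter> space M = {x \<in> space M. X (Suc t) x = d}"
    by (auto simp: fut_def B_def)
  ultimately show ?thesis using dice_prob[of "Suc t" d] assms by simp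
qed

text \<open>
  Truncating the path after time \<open>t\<close> turns an arbitrary predicate on paths into one that depends
  only on the first \<open>t\<close> throws.
\<close>
lemma walk_event: "{x \<in> space M. P (\<lambda>i. if i \<le> t then walk X s i x else 0)} \<in> events"
proof -
  have "(\<lambda>i. if i \<le> t then walk X s i x else 0) =
      (\<lambda>i. if i \<le> t then walk (\<lambda>i f. f i) s i (restrict (\<lambda>i. X i x) {1..t}) else 0)" for x
    by (simp add: walk_restrict[unfolded One_nat_def] fun_eq_iff del: restrict_apply)
  thus ?thesis
    by (simp only: history_event[of "\<lambda>f. P (\<lambda>i. if i \<le> t then walk (\<lambda>i f. f i) s i f else 0)"])
qed

lemma first_visit_event: "{x \<in> space M. int (walk X s t x) = y \<and> (\<forall>i<t. walk X s i x \<notin> H)} \<in> events"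
  using walk_event[of "\<lambda>S. int (S t) = y \<and> (\<forall>i<t. S i \<notin> H)" t s] by (simp cong: conj_cong)

lemma prob_first_visit:
  "prob {x \<in> space M. int (walk X s t x) = y \<and> (\<forall>i<t. walk X s i x \<notin> H)} = visit_prob H s t y"
proof (induction t arbitrary: y)
  case 0
  show ?case by (cases "y = int s") (simp_all add: prob_space)
next
  case (Suc t)
  define E where "E = (\<lambda>d. {x \<in> space M. (int (walk X s t x) = y - int d \<and> (\<forall>i<t. walk X s i x \<notin> H)) \<and> X (Suc t) x = d})"
  have E_restrict: "E d = {x \<in> space M. (\<lambda>f. int (walk (\<lambda>i f. f i) s t f) = y - int d \<and> (\<forall>i<t. walk (\<lambda>i f. f i) s i f \<notin> H))
        (restrict (\<lambda>i. X i x) {1..t}) \<and> X (Suc t) x = d}" for d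
    unfolding E_def by (simp add: walk_restrict[unfolded One_nat_def] del: restrict_apply cong: conj_cong)
  have E_prob: "prob (E d) = visit_prob H s t (y - int d) / 6" if "d \<in> {1..6}" for d
  proof -
    have "prob (E d) = prob {x \<in> space M. (\<lambda>f. int (walk (\<lambda>i f. f i) s t f) = y - int d \<and> (\<forall>i<t. walk (\<lambda>i f. f i) s i f \<notin> H))
        (restrict (\<lambda>i. X i x) {1..t})} / 6"
      unfolding E_restrict by (rule next_step_indep[OF that])
    also have "\<dots> = prob {x \<in> space M. int (walk X s t x) = y - int d \<and> (\<forall>i<t. walk X s i x \<notin> H)} / 6"
      by (simp add: walk_restrict[unfolded One_nat_def] del: restrict_apply cong: conj_cong)
    finally show ?thesis by (simp add: Suc.IH)
  qed
  have E_event: "E d \<in> events" for d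
  proof -
    have "E d = {x \<in> space M. int (walk X s t x) = y - int d \<and> (\<forall>i<t. walk X s i x \<notin> H)} \<inter> (X (Suc t) -` {d} \<inter> space M)"
      by (auto simp: E_def)
    thus ?thesis using first_visit_event measurable_sets[OF dice_measurable, of "Suc t" "{d}"] by auto
  qed
  \<comment> \<open>The last throws whose predecessor position is not killed.\<close>
  define D where "D = {d \<in> {1..6}. nat (y - int d) \<notin> H}"
  have "prob {x \<in> space M. int (walk X s (Suc t) x) = y \<and> (\<forall>i<Suc t. walk X s i x \<notin> H)} = prob (\<Union>d\<in>D. E d)"
  proof (rule finite_measure_eq_AE)
    show "AE x in M. x \<in> {x \<in> space M. int (walk X s (Suc t) x) = y \<and> (\<forall>i<Suc t. walk X s i x \<notin> H)}
        \<longleftrightarrow> x \<in> (\<Union>d\<in>D. E d)"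
      using AE_dice
    proof eventually_elim
      case (elim x)
      hence "X (Suc t) x \<in> {1..6}" by auto
      moreover have "nat (y - int d) = walk X s t x" if "int (walk X s t x) = y - int d" for d
        using that by linarith
      ultimately show ?case
        by (auto simp: E_def D_def walk_Suc less_Suc_eq)
    qed
  qed (use first_visit_event[of s "Suc t" y H] E_event in \<open>auto simp: D_def\<close>)
  also have "\<dots> = (\<Sum>d\<in>D. prob (E d))"
    by (rule finite_measure_finite_Union) (use E_event in \<open>auto simp: D_def disjoint_family_on_def E_def\<close>)
  also have "\<dots> = (\<Sum>d\<in>D. visit_prob H s t (y - int d) / 6)"
    by (intro sum.cong E_prob) (auto simp: D_def)
  also have "\<dots> = visit_prob H s (Suc t) y"
    unfolding visit_prob.simps sum_divide_distrib D_def
    by (rule sum.mono_neutral_cong_left) auto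
  finally show ?case .
qed

end

section \<open>Paths, hitting times and the survival event\<close>

lemma INF_enat_eq_enat_iff:
  "(INF t\<in>{t. P t}. enat t) = enat n \<longleftrightarrow> P n \<and> (\<forall>i<n. \<not> P i)"
proof
  assume eq: "(INF t\<in>{t. P t}. enat t) = enat n"
  have ne: "{t. P t} \<noteq> {}"
  proof
    assume "{t. P t} = {}"
    with eq show False by (simp only: image_empty Inf_empty top_enat_def) simp
  qed
  hence "Inf (enat ` {t. P t}) \<in> enat ` {t. P t}"
    unfolding Inf_enat_def by (auto intro: LeastI)
  hence "P n" using eq by auto
  moreover have "\<not> P i" if "i < n" for i
    using INF_lower[of i "{t. P t}" enat] that eq by auto
  ultimately show "P n \<and> (\<forall>i<n. \<not> P i)" by blast
next
  assume "P n \<and> (\<forall>i<n. \<not> P i)"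
  thus "(INF t\<in>{t. P t}. enat t) = enat n"
    by (intro antisym INF_lower INF_greatest) (auto simp: not_less[symmetric])
qed

lemma hit_time_eq_enat_iff:
  "hit_time X s H x = enat t \<longleftrightarrow> walk X s t x \<in> H \<and> (\<forall>i<t. walk X s i x \<notin> H)"
  unfolding hit_time_def by (rule INF_enat_eq_enat_iff)

lemma exceed_time_eq_hit_time: "exceed_time X s N = hit_time X s {N<..}"
  by (rule ext) (simp add: exceed_time_def hit_time_def)

text \<open>
  The almost sure property of a path that makes all statements about hitting times pathwise.
\<close>
definition die_path :: "(nat \<Rightarrow> 'a \<Rightarrow> nat) \<Rightarrow> 'a \<Rightarrow> bool" where
  "die_path X x \<longleftrightarrow> (\<forall>i\<ge>1. X i x \<in> {1..6})"

definition first_hit_at :: "'a measure \<Rightarrow> (nat \<Rightarrow> 'a \<Rightarrow> nat) \<Rightarrow> nat \<Rightarrow> nat set \<Rightarrow> nat \<Rightarrow> 'a set" where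
  "first_hit_at M X s H y =
     {x \<in> space M. \<exists>t. walk X s t x = y \<and> (\<forall>i<t. walk X s i x \<notin> H)}"

lemma walk_increment:
  assumes "die_path X x" "i \<le> j"
  shows "walk X s i x + (j - i) \<le> walk X s j x" "walk X s j x \<le> walk X s i x + 6 * (j - i)"
proof -
  have "walk X s i x + (j - i) \<le> walk X s j x \<and> walk X s j x \<le> walk X s i x + 6 * (j - i)"
    using assms(2)
  proof (induction j rule: dec_induct)
    case (step j)
    have "X (Suc j) x \<in> {1..6}" using assms(1) by (simp add: die_path_def)
    thus ?case using step by (auto simp: walk_Suc)
  qed simp
  thus "walk X s i x + (j - i) \<le> walk X s j x" "walk X s j x \<le> walk X s i x + 6 * (j - i)" by auto
qed

lemma exceed_time_finite:
  assumes "die_path X x" "s \<le> N"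
  obtains t where "exceed_time X s N x = enat t" "t \<ge> 1" "walk X s t x > N" "walk X s (t - 1) x \<le> N"
proof -
  have "walk X s (Suc N) x > N"
    using walk_increment(1)[OF assms(1), of 0 "Suc N" s] by simp
  then obtain t where t: "walk X s t x > N" "\<forall>i<t. \<not> walk X s i x > N"
    using exists_least_iff[of "\<lambda>t. walk X s t x > N"] by blast
  moreover from t(1) assms(2) have "t \<ge> 1" by (cases t) auto
  ultimately show thesis
    by (intro that[of t]) (auto simp: exceed_time_eq_hit_time hit_time_eq_enat_iff not_less)
qed

lemma power2_in_squares: "K \<ge> 1 \<Longrightarrow> K\<^sup>2 \<in> squares"
  by (auto simp: squares_def)

text \<open>
  The only use of \<open>4 \<le> K\<close> in the path argument: the next square is at least \<open>K\<^sup>2 + 9\<close>, out of reach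
  of the throw that crosses \<open>K\<^sup>2\<close>.
\<close>
lemma near_square_notin_squares:
  assumes "K \<ge> 4" "K\<^sup>2 < y" "y \<le> K\<^sup>2 + 6"
  shows "y \<notin> squares"
  by (rule between_squares[of K]) (use assms in \<open>auto simp: power2_eq_square\<close>)

lemma survival_overshoot:
  assumes "die_path X x" "s \<le> K\<^sup>2" "K \<ge> 1" "exceed_time X s (K\<^sup>2) x < hit_time X s squares x"
  obtains t where "exceed_time X s (K\<^sup>2) x = enat t" "K\<^sup>2 < walk X s t x" "walk X s t x \<le> K\<^sup>2 + 5"
proof -
  obtain t where t: "exceed_time X s (K\<^sup>2) x = enat t" "t \<ge> 1" "walk X s t x > K\<^sup>2" "walk X s (t - 1) x \<le> K\<^sup>2"
    using exceed_time_finite[OF assms(1,2)] by metis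
  have "walk X s (t - 1) x \<notin> squares"
  proof
    assume "walk X s (t - 1) x \<in> squares"
    hence "hit_time X s squares x \<le> enat (t - 1)" unfolding hit_time_def by (intro INF_lower) auto
    also have "enat (t - 1) < enat t" using t(2) by simp
    finally show False using assms(4) t(1) by auto
  qed
  hence "walk X s (t - 1) x \<noteq> K\<^sup>2" using power2_in_squares[OF assms(3)] by auto
  hence "walk X s t x \<le> K\<^sup>2 + 5"
    using t(2,4) walk_increment(2)[OF assms(1), of "t - 1" t s] by simp
  thus thesis using that t by blast
qed

text \<open>
  The walk crosses \<open>K\<^sup>2\<close> in finite time and not onto a square, so it survives unless the first
  square it meets is at most \<open>K\<^sup>2\<close>. This removes the two times from the survival event.
\<close>
lemma survival_iff:
  assumes "die_path X x" "s \<le> K\<^sup>2" "K \<ge> 4" "x \<in> space M"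
  shows "exceed_time X s (K\<^sup>2) x < hit_time X s squares x \<longleftrightarrow>
    (\<forall>y\<in>squares \<inter> {..K\<^sup>2}. x \<notin> first_hit_at M X s squares y)"
proof -
  obtain t0 where t0: "exceed_time X s (K\<^sup>2) x = enat t0" "t0 \<ge> 1" "walk X s t0 x > K\<^sup>2" "walk X s (t0 - 1) x \<le> K\<^sup>2"
    using exceed_time_finite[OF assms(1,2)] by metis
  show ?thesis
  proof (intro iffI ballI notI)
    fix y assume less: "exceed_time X s (K\<^sup>2) x < hit_time X s squares x"
      and y: "y \<in> squares \<inter> {..K\<^sup>2}" "x \<in> first_hit_at M X s squares y"
    then obtain t where t: "walk X s t x = y" "\<forall>i<t. walk X s i x \<notin> squares"
      by (auto simp: first_hit_at_def)
    hence "hit_time X s squares x = enat t" using y by (simp add: hit_time_eq_enat_iff)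
    hence "t0 \<le> t" using less t0 by simp
    hence "walk X s t0 x \<le> walk X s t x" using walk_increment(1)[OF assms(1), of t0 t s] by simp
    thus False using y t t0 by simp
  next
    assume none: "\<forall>y\<in>squares \<inter> {..K\<^sup>2}. x \<notin> first_hit_at M X s squares y"
    show "exceed_time X s (K\<^sup>2) x < hit_time X s squares x"
    proof (cases "hit_time X s squares x")
      case (enat t)
      hence t: "walk X s t x \<in> squares" "\<forall>i<t. walk X s i x \<notin> squares"
        by (simp_all add: hit_time_eq_enat_iff)
      hence "x \<in> first_hit_at M X s squares (walk X s t x)"
        using assms(4) by (auto simp: first_hit_at_def)
      hence "walk X s t x > K\<^sup>2"
        using none t(1) by (meson IntI atMost_iff not_le)
      hence "\<not> t < t0"
        using t0(1) by (auto simp: exceed_time_eq_hit_time hit_time_eq_enat_iff)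
      moreover have "walk X s t0 x \<notin> squares"
        using t0 walk_increment(2)[OF assms(1), of "t0 - 1" t0 s]
        by (intro near_square_notin_squares[OF assms(3)]) auto
      hence "t \<noteq> t0" using t by auto
      ultimately show ?thesis using enat t0 by simp
    qed (use t0 in simp)
  qed
qed

text \<open>
  The position at the crossing lies in \<open>K\<^sup>2 + 1, \<dots>, K\<^sup>2 + 5\<close> and each of the \<open>n\<close> remaining steps
  gains between \<open>1\<close> and \<open>6\<close>.
\<close>
lemma first_hit_duration:
  assumes "die_path X x" "s \<le> K\<^sup>2" "K \<ge> 1" "exceed_time X s (K\<^sup>2) x < hit_time X s squares x"
    and "x \<in> first_hit_at M X s squares y" "y \<in> squares"
  obtains n where "hit_time X s squares x - exceed_time X s (K\<^sup>2) x = enat n"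
    "y \<le> K\<^sup>2 + 5 + 6 * n" "K\<^sup>2 + 1 + n \<le> y"
proof -
  obtain t0 where t0: "exceed_time X s (K\<^sup>2) x = enat t0" "K\<^sup>2 < walk X s t0 x" "walk X s t0 x \<le> K\<^sup>2 + 5"
    using survival_overshoot[OF assms(1-4)] by metis
  obtain t where t: "walk X s t x = y" "\<forall>i<t. walk X s i x \<notin> squares"
    using assms(5) by (auto simp: first_hit_at_def)
  hence hit: "hit_time X s squares x = enat t" using assms(6) by (simp add: hit_time_eq_enat_iff)
  hence "t0 \<le> t" using assms(4) t0 by simp
  thus thesis
    using that[of "t - t0"] hit t0 t walk_increment[OF assms(1), of t0 t s] by simp
qed

lemma first_hit_at_disjoint:
  assumes "y \<in> H" "y' \<in> H" "x \<in> first_hit_at M X s H y" "x \<in> first_hit_at M X s H y'"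
  shows "y = y'"
proof -
  obtain t t' where "walk X s t x = y" "\<forall>i<t. walk X s i x \<notin> H" "walk X s t' x = y'" "\<forall>i<t'. walk X s i x \<notin> H"
    using assms(3,4) by (auto simp: first_hit_at_def)
  moreover from this have "t = t'" using assms(1,2) by (metis linorder_neqE_nat)
  ultimately show ?thesis by simp
qed

context
  fixes M :: "'a measure" and X :: "nat \<Rightarrow> 'a \<Rightarrow> nat"
  assumes iid: "iid_dice M X"
begin

interpretation prob_space M
  using iid by (simp add: iid_dice_def)

lemma AE_die_path: "AE x in M. die_path X x"
  using AE_dice[OF iid] by (simp add: die_path_def)

lemma first_hit_at_eq_Union:
  "first_hit_at M X s H y = (\<Union>t. {x \<in> space M. int (walk X s t x) = int y \<and> (\<forall>i<t. walk X s i x \<notin> H)})"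
  by (auto simp: first_hit_at_def)

lemma first_hit_at_event: "first_hit_at M X s H y \<in> events"
  unfolding first_hit_at_eq_Union using first_visit_event[OF iid] by (intro sets.countable_UN) blast

lemma prob_first_hit_at:
  assumes "y \<in> H"
  shows "prob (first_hit_at M X s H y) = reach H s (int y)"
proof -
  have same: "t = t'" if "walk X s t x = y" "walk X s t' x = y"
    "\<forall>i<t. walk X s i x \<notin> H" "\<forall>i<t'. walk X s i x \<notin> H" for t t' x
    using that assms by (metis linorder_neqE_nat)
  have "(\<lambda>t. prob {x \<in> space M. int (walk X s t x) = int y \<and> (\<forall>i<t. walk X s i x \<notin> H)}) sums prob (first_hit_at M X s H y)"
    unfolding first_hit_at_eq_Union
  proof (rule finite_measure_UNION)
    show "disjoint_family (\<lambda>t. {x \<in> space M. int (walk X s t x) = int y \<and> (\<forall>i<t. walk X s i x \<notin> H)})"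
      unfolding disjoint_family_on_def using same by auto
  qed (use first_visit_event[OF iid] in blast)
  hence "(\<lambda>t. visit_prob H s t (int y)) sums prob (first_hit_at M X s H y)"
    by (simp only: prob_first_visit[OF iid])
  moreover have "(\<lambda>t. visit_prob H s t (int y)) sums (\<Sum>t\<le>nat (int y). visit_prob H s t (int y))"
    by (rule sums_finite) (auto intro: visit_prob_eq_0)
  ultimately show ?thesis unfolding reach_def by (rule sums_unique2)
qed

text \<open>
  The crossing mass is by definition a sum over last positions before the jump; conservation of
  mass turns it into the complement of a disjoint union, so the jump itself never has to be
  described as an event.
\<close>
lemma prob_no_hit_upto:
  assumes "s \<le> n"
  shows "prob {x \<in> space M. \<forall>y\<in>H \<inter> {..n}. x \<notin> first_hit_at M X s H y} = crossing_mass H s (int n)"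
proof -
  have "prob (\<Union>y\<in>H \<inter> {..n}. first_hit_at M X s H y) = (\<Sum>y\<in>H \<inter> {..n}. prob (first_hit_at M X s H y))"
    by (rule finite_measure_finite_Union)
      (auto simp: disjoint_family_on_def first_hit_at_event dest: first_hit_at_disjoint[rotated 2])
  also have "\<dots> = (\<Sum>y\<in>H \<inter> {..n}. reach H s (int y))"
    by (intro sum.cong prob_first_hit_at) auto
  finally have "prob (space M - (\<Union>y\<in>H \<inter> {..n}. first_hit_at M X s H y)) = crossing_mass H s (int n)"
    using assms by (subst prob_compl) (auto simp: crossing_mass_eq first_hit_at_event)
  also have "space M - (\<Union>y\<in>H \<inter> {..n}. first_hit_at M X s H y) = {x \<in> space M. \<forall>y\<in>H \<inter> {..n}. x \<notin> first_hit_at M X s H y}"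
    by auto
  finally show ?thesis .
qed

lemma hit_time_measurable: "hit_time X s H \<in> measurable M (count_space UNIV)"
proof -
  have fin: "hit_time X s H -` {enat t} \<inter> space M \<in> events" for t
  proof -
    have "{x \<in> space M. walk X s t x \<in> H \<and> (\<forall>i<t. walk X s i x \<notin> H)} \<in> events"
      using walk_event[OF iid, of "\<lambda>S. S t \<in> H \<and> (\<forall>i<t. S i \<notin> H)" t s] by (simp cong: conj_cong)
    also have "{x \<in> space M. walk X s t x \<in> H \<and> (\<forall>i<t. walk X s i x \<notin> H)} = hit_time X s H -` {enat t} \<inter> space M"
      by (auto simp: hit_time_eq_enat_iff)
    finally show ?thesis .
  qed
  have "hit_time X s H -` {\<infinity>} \<inter> space M = space M - (\<Union>t. hit_time X s H -` {enat t} \<inter> space M)"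
    by (auto simp: not_infinity_eq)
  also have "\<dots> \<in> events" using fin by blast
  finally have "hit_time X s H -` {a} \<inter> space M \<in> events" for a
    using fin by (cases a) auto
  thus ?thesis by (subst measurable_count_space_eq2_countable) auto
qed

lemma survival_event_measurable: "survival_event M X s H N \<in> events"
proof -
  have "Measurable.pred M (\<lambda>x. hit_time X s {N<..} x < hit_time X s H x)"
    by (rule measurable_compose_countable[OF _ hit_time_measurable, of "\<lambda>i x. i < hit_time X s H x"])
      (rule measurable_compose[OF hit_time_measurable], simp)
  thus ?thesis unfolding survival_event_def exceed_time_eq_hit_time by (simp add: pred_def)
qed

lemma duration_measurable:
  "(\<lambda>x. ennreal_of_enat (hit_time X s H x - exceed_time X s N x)) \<in> borel_measurable M"
  unfolding exceed_time_eq_hit_time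
  by (rule measurable_compose_countable[OF _ hit_time_measurable,
        of "\<lambda>i x. ennreal_of_enat (i - hit_time X s {N<..} x)"])
    (rule measurable_compose[OF hit_time_measurable], simp)

end

section \<open>Geometric comparison and the conditional expectation\<close>

lemma summable_quadratic_times_geometric:
  fixes x b k :: real
  assumes "0 < x" "x < 1"
  shows "summable (\<lambda>j. ((k + 1 + real j)\<^sup>2 - k\<^sup>2 - b) * x ^ j)"
proof (rule summable_comparison_test_bigo)
  show "summable (\<lambda>j. norm (((1 + x) / 2) ^ j))"
    using assms by (simp add: norm_power summable_geometric)
  show "(\<lambda>j. ((k + 1 + real j)\<^sup>2 - k\<^sup>2 - b) * x ^ j) \<in> O(\<lambda>j. ((1 + x) / 2) ^ j)"
    using assms by real_asymp
qed

lemma suminf_strict_mono: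
  fixes f g :: "nat \<Rightarrow> real"
  assumes "summable f" "summable g" "\<And>n. f n < g n"
  shows "suminf f < suminf g"
  using suminf_pos[of "\<lambda>n. g n - f n"] assms by (simp add: summable_diff suminf_diff[symmetric])

text \<open>
  Surviving one more square multiplies the mass by a factor between \<open>5/7 - eps K\<close> and
  \<open>5/7 + eps K\<close>. Positivity is part of the induction because \<open>hazard_error\<close> assumes it.
\<close>
lemma survivor_mass_geometric:
  assumes "K \<ge> 4" "s \<le> K\<^sup>2" "survivor_mass s K > 0"
  shows "survivor_mass s (K + j) > 0"
    and "(5 / 7 - eps K) ^ j * survivor_mass s K \<le> survivor_mass s (K + j)"
    and "survivor_mass s (K + j) \<le> (5 / 7 + eps K) ^ j * survivor_mass s K"
proof -
  have "survivor_mass s (K + j) > 0 \<and> (5 / 7 - eps K) ^ j * survivor_mass s K \<le> survivor_mass s (K + j)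
    \<and> survivor_mass s (K + j) \<le> (5 / 7 + eps K) ^ j * survivor_mass s K"
  proof (induction j)
    case (Suc j)
    have le: "s \<le> (K + j)\<^sup>2" using assms(2) by (rule order_trans) (auto intro: power_mono)
    have "\<bar>reach squares s (int ((K + j + 1)\<^sup>2)) - 2 / 7 * survivor_mass s (K + j)\<bar> < eps K * survivor_mass s (K + j)"
      by (rule hazard_error) (use assms(1) le Suc.IH in auto)
    hence bounds: "(5 / 7 - eps K) * survivor_mass s (K + j) < survivor_mass s (K + Suc j)"
      "survivor_mass s (K + Suc j) < (5 / 7 + eps K) * survivor_mass s (K + j)"
      using survivor_mass_Suc[OF le] by (auto simp: algebra_simps abs_less_iff)
    have "0 < 5 / 7 - eps K" using eps_less[OF assms(1)] by simp
    hence "0 < (5 / 7 - eps K) * survivor_mass s (K + j)" using Suc.IH by simp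
    moreover have "(5 / 7 - eps K) ^ Suc j * survivor_mass s K \<le> (5 / 7 - eps K) * survivor_mass s (K + j)"
      using Suc.IH \<open>0 < 5 / 7 - eps K\<close> by (simp add: mult.assoc)
    moreover have "(5 / 7 + eps K) * survivor_mass s (K + j) \<le> (5 / 7 + eps K) ^ Suc j * survivor_mass s K"
      using Suc.IH eps_pos[of K] by (simp add: mult.assoc)
    ultimately show ?case using bounds by linarith
  qed (use assms in simp)
  thus "survivor_mass s (K + j) > 0"
    and "(5 / 7 - eps K) ^ j * survivor_mass s K \<le> survivor_mass s (K + j)"
    and "survivor_mass s (K + j) \<le> (5 / 7 + eps K) ^ j * survivor_mass s K"
    by auto
qed

lemma reach_square_geometric:
  assumes "K \<ge> 4" "s \<le> K\<^sup>2" "survivor_mass s K > 0"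
  shows "(5 / 7 - eps K) ^ j * (2 / 7 - eps K) * survivor_mass s K < reach squares s (int ((K + 1 + j)\<^sup>2))"
    and "reach squares s (int ((K + 1 + j)\<^sup>2)) < (5 / 7 + eps K) ^ j * (2 / 7 + eps K) * survivor_mass s K"
proof -
  note geo = survivor_mass_geometric[OF assms, of j]
  have le: "s \<le> (K + j)\<^sup>2" using assms(2) by (rule order_trans) (auto intro: power_mono)
  have "\<bar>reach squares s (int ((K + j + 1)\<^sup>2)) - 2 / 7 * survivor_mass s (K + j)\<bar> < eps K * survivor_mass s (K + j)"
    by (rule hazard_error) (use assms(1) le geo(1) in auto)
  hence bounds: "(2 / 7 - eps K) * survivor_mass s (K + j) < reach squares s (int ((K + 1 + j)\<^sup>2))"
    "reach squares s (int ((K + 1 + j)\<^sup>2)) < (2 / 7 + eps K) * survivor_mass s (K + j)"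
    by (auto simp: algebra_simps abs_less_iff)
  have "(2 / 7 - eps K) * ((5 / 7 - eps K) ^ j * survivor_mass s K) \<le> (2 / 7 - eps K) * survivor_mass s (K + j)"
    using eps_less[OF assms(1)] geo(2) by (intro mult_left_mono) auto
  thus "(5 / 7 - eps K) ^ j * (2 / 7 - eps K) * survivor_mass s K < reach squares s (int ((K + 1 + j)\<^sup>2))"
    using bounds(1) by (simp add: mult_ac)
  have "(2 / 7 + eps K) * survivor_mass s (K + j) \<le> (2 / 7 + eps K) * ((5 / 7 + eps K) ^ j * survivor_mass s K)"
    using eps_pos[of K] geo(3) by (intro mult_left_mono) auto
  thus "reach squares s (int ((K + 1 + j)\<^sup>2)) < (5 / 7 + eps K) ^ j * (2 / 7 + eps K) * survivor_mass s K"
    using bounds(2) by (simp add: mult_ac)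
qed

lemma squares_beyond:
  assumes "y \<in> squares" "y > K\<^sup>2"
  obtains j where "y = (K + 1 + j)\<^sup>2"
proof -
  obtain n where n: "y = n\<^sup>2" using assms(1) by (auto simp: squares_def)
  hence "K < n" using assms(2) power_less_imp_less_base[of K 2 n] by simp
  then obtain j where "n = K + 1 + j" using le_Suc_ex[of "K + 1" n] by auto
  thus thesis using n that by blast
qed

context
  fixes M :: "'a measure" and X :: "nat \<Rightarrow> 'a \<Rightarrow> nat" and K s :: nat
  assumes iid: "iid_dice M X" and K: "K \<ge> 4" and s: "s \<le> K\<^sup>2"
    and pos: "measure M (survival_event M X s squares (K\<^sup>2)) > 0"
begin

interpretation prob_space M
  using iid by (simp add: iid_dice_def)

lemma prob_survival_event: "prob (survival_event M X s squares (K\<^sup>2)) = survivor_mass s K"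
proof -
  have "prob (survival_event M X s squares (K\<^sup>2)) =
      prob {x \<in> space M. \<forall>y\<in>squares \<inter> {..K\<^sup>2}. x \<notin> first_hit_at M X s squares y}"
  proof (rule finite_measure_eq_AE)
    show "AE x in M. x \<in> survival_event M X s squares (K\<^sup>2) \<longleftrightarrow>
        x \<in> {x \<in> space M. \<forall>y\<in>squares \<inter> {..K\<^sup>2}. x \<notin> first_hit_at M X s squares y}"
      using AE_die_path[OF iid] AE_space
      by eventually_elim (simp only: survival_event_def mem_Collect_eq survival_iff[OF _ s K])
    show "{x \<in> space M. \<forall>y\<in>squares \<inter> {..K\<^sup>2}. x \<notin> first_hit_at M X s squares y} \<in> events"
      using first_hit_at_event[OF iid] by measurable
  qed (rule survival_event_measurable[OF iid])
  thus ?thesis using prob_no_hit_upto[OF iid s] by simp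
qed

text \<open>
  The probability of missing all squares up to \<open>(K + j)\<^sup>2\<close> is at most a constant times
  \<open>(5/7 + eps K) ^ j\<close>, which tends to \<open>0\<close>.
\<close>
lemma AE_some_hit: "AE x in M. \<exists>y\<in>squares. x \<in> first_hit_at M X s squares y"
proof -
  define E where "E = {x \<in> space M. \<forall>y\<in>squares. x \<notin> first_hit_at M X s squares y}"
  have E_event: "E \<in> events"
  proof -
    have "E = space M - (\<Union>y\<in>squares. first_hit_at M X s squares y)" by (auto simp: E_def)
    thus ?thesis using first_hit_at_event[OF iid] by auto
  qed
  have le: "prob E \<le> (5 / 7 + eps K) ^ j * survivor_mass s K" for j
  proof -
    have "s \<le> (K + j)\<^sup>2" using s by (rule order_trans) (auto intro: power_mono)
    have "prob E \<le> prob {x \<in> space M. \<forall>y\<in>squares \<inter> {..(K + j)\<^sup>2}. x \<notin> first_hit_at M X s squares y}"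
      by (rule finite_measure_mono) (use first_hit_at_event[OF iid] in \<open>auto simp: E_def\<close>)
    also have "\<dots> = survivor_mass s (K + j)" by (rule prob_no_hit_upto[OF iid]) fact
    also have "\<dots> \<le> (5 / 7 + eps K) ^ j * survivor_mass s K"
      by (rule survivor_mass_geometric) (use K s pos prob_survival_event in auto)
    finally show ?thesis .
  qed
  have "(\<lambda>j. (5 / 7 + eps K) ^ j * survivor_mass s K) \<longlonglongrightarrow> 0 * survivor_mass s K"
    using eps_less[OF K] eps_pos[of K] by (intro tendsto_intros LIMSEQ_realpow_zero) auto
  hence "prob E \<le> 0" using le by (intro LIMSEQ_le_const) auto
  hence "prob E = 0" by (simp add: measure_le_0_iff)
  hence "AE x in M. x \<notin> E" using E_event by (simp add: prob_eq_0)
  thus ?thesis using AE_space by eventually_elim (auto simp: E_def)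
qed

lemma nn_integral_first_hits:
  assumes "\<And>j. 0 \<le> c j" "summable (\<lambda>j. c j * reach squares s (int ((K + 1 + j)\<^sup>2)))"
  shows "(\<integral>\<^sup>+ x. (\<Sum>j. ennreal (c j) * indicator (first_hit_at M X s squares ((K + 1 + j)\<^sup>2)) x) \<partial>M) =
    ennreal (\<Sum>j. c j * reach squares s (int ((K + 1 + j)\<^sup>2)))"
proof -
  have "(\<integral>\<^sup>+ x. (\<Sum>j. ennreal (c j) * indicator (first_hit_at M X s squares ((K + 1 + j)\<^sup>2)) x) \<partial>M) =
      (\<Sum>j. ennreal (c j) * emeasure M (first_hit_at M X s squares ((K + 1 + j)\<^sup>2)))"
    using first_hit_at_event[OF iid] by (simp add: nn_integral_suminf nn_integral_cmult_indicator)
  also have "\<dots> = (\<Sum>j. ennreal (c j * reach squares s (int ((K + 1 + j)\<^sup>2))))"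
  proof (rule suminf_cong)
    fix j
    have "(K + 1 + j)\<^sup>2 \<in> squares" by (rule power2_in_squares) simp
    thus "ennreal (c j) * emeasure M (first_hit_at M X s squares ((K + 1 + j)\<^sup>2)) = ennreal (c j * reach squares s (int ((K + 1 + j)\<^sup>2)))"
      by (simp only: emeasure_eq_measure prob_first_hit_at[OF iid] ennreal_mult' assms(1))
  qed
  also have "\<dots> = ennreal (\<Sum>j. c j * reach squares s (int ((K + 1 + j)\<^sup>2)))"
    using assms by (intro suminf_ennreal2) (auto intro!: mult_nonneg_nonneg reach_nonneg)
  finally show ?thesis .
qed

text \<open>
  At most one summand is nonzero at a given point, namely the one for the first square hit. So
  the series are the bounds of \<open>first_hit_duration\<close> expressed as random variables.
\<close>
lemma duration_pointwise_bounds: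
  defines "Y \<equiv> \<lambda>x. ennreal_of_enat (hit_time X s squares x - exceed_time X s (K\<^sup>2) x) *
      indicator (survival_event M X s squares (K\<^sup>2)) x"
  shows "AE x in M. (\<Sum>j. ennreal (((real K + 1 + real j)\<^sup>2 - (real K)\<^sup>2 - 5) / 6) *
      indicator (first_hit_at M X s squares ((K + 1 + j)\<^sup>2)) x) \<le> Y x"
    and "AE x in M. Y x \<le> (\<Sum>j. ennreal ((real K + 1 + real j)\<^sup>2 - (real K)\<^sup>2 - 1) *
      indicator (first_hit_at M X s squares ((K + 1 + j)\<^sup>2)) x)"
proof -
  let ?F = "\<lambda>y. first_hit_at M X s squares y"
  have sq: "(K + 1 + j)\<^sup>2 \<in> squares" for j by (rule power2_in_squares) simp
  have disj: "disjoint_family (\<lambda>j. ?F ((K + 1 + j)\<^sup>2))"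
    unfolding disjoint_family_on_def
  proof (intro ballI impI)
    fix i j :: nat assume "i \<noteq> j"
    hence "(K + 1 + i)\<^sup>2 \<noteq> (K + 1 + j)\<^sup>2" by (simp only: power2_eq_iff_nonneg)
    thus "?F ((K + 1 + i)\<^sup>2) \<inter> ?F ((K + 1 + j)\<^sup>2) = {}"
      by (intro equals0I) (metis IntE first_hit_at_disjoint sq)
  qed
  have "AE x in M. (\<Sum>j. ennreal (((real K + 1 + real j)\<^sup>2 - (real K)\<^sup>2 - 5) / 6) * indicator (?F ((K + 1 + j)\<^sup>2)) x) \<le> Y x
      \<and> Y x \<le> (\<Sum>j. ennreal ((real K + 1 + real j)\<^sup>2 - (real K)\<^sup>2 - 1) * indicator (?F ((K + 1 + j)\<^sup>2)) x)"
    using AE_die_path[OF iid] AE_some_hit AE_space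
  proof eventually_elim
    case (elim x)
    note surv = survival_iff[OF elim(1) s K elim(3)]
    obtain y where y: "y \<in> squares" "x \<in> ?F y" using elim(2) by blast
    show ?case
    proof (cases "y > K\<^sup>2")
      case True
      then obtain j where j: "y = (K + 1 + j)\<^sup>2" using squares_beyond y(1) by blast
      have "exceed_time X s (K\<^sup>2) x < hit_time X s squares x"
        unfolding surv using first_hit_at_disjoint[OF y(1) _ y(2)] True by fastforce
      moreover from this obtain n where n: "hit_time X s squares x - exceed_time X s (K\<^sup>2) x = enat n"
        "y \<le> K\<^sup>2 + 5 + 6 * n" "K\<^sup>2 + 1 + n \<le> y"
        using first_hit_duration[OF elim(1) s _ _ y(2,1)] K by auto
      ultimately have Y: "Y x = ennreal (real n)"
        using elim(3) by (simp add: Y_def survival_event_def ennreal_of_nat_eq_real_of_nat)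
      have "real y \<le> real (K\<^sup>2 + 5 + 6 * n)" "real (K\<^sup>2 + 1 + n) \<le> real y"
        using n(2,3) by (simp_all only: of_nat_le_iff)
      hence "((real K + 1 + real j)\<^sup>2 - (real K)\<^sup>2 - 5) / 6 \<le> real n"
        "real n \<le> (real K + 1 + real j)\<^sup>2 - (real K)\<^sup>2 - 1"
        by (simp_all add: j add_ac)
      moreover have xj: "x \<in> ?F ((K + 1 + j)\<^sup>2)" using y(2) j by simp
      ultimately show ?thesis
        unfolding Y suminf_cmult_indicator[OF disj xj] by (auto intro: ennreal_leI)
    next
      case False
      hence "\<not> exceed_time X s (K\<^sup>2) x < hit_time X s squares x"
        unfolding surv using y by auto
      hence "Y x = 0" by (simp add: Y_def survival_event_def)
      moreover have "x \<notin> ?F ((K + 1 + j)\<^sup>2)" for j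
      proof
        assume "x \<in> ?F ((K + 1 + j)\<^sup>2)"
        hence "y = (K + 1 + j)\<^sup>2" by (rule first_hit_at_disjoint[OF y(1) sq y(2)])
        moreover have "K\<^sup>2 < (K + 1 + j)\<^sup>2" by (intro power_strict_mono) auto
        ultimately show False using False by simp
      qed
      ultimately show ?thesis by simp
    qed
  qed
  thus "AE x in M. (\<Sum>j. ennreal (((real K + 1 + real j)\<^sup>2 - (real K)\<^sup>2 - 5) / 6) * indicator (?F ((K + 1 + j)\<^sup>2)) x) \<le> Y x"
    and "AE x in M. Y x \<le> (\<Sum>j. ennreal ((real K + 1 + real j)\<^sup>2 - (real K)\<^sup>2 - 1) * indicator (?F ((K + 1 + j)\<^sup>2)) x)"
    by (auto elim: eventually_mono)
qed

lemma square_gap_gt: "(real K + 1 + real j)\<^sup>2 - (real K)\<^sup>2 > 5"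
proof -
  have "(real K + 1)\<^sup>2 \<le> (real K + 1 + real j)\<^sup>2" by (rule power_mono) auto
  moreover have "(real K + 1)\<^sup>2 - (real K)\<^sup>2 = 2 * real K + 1"
    by (simp add: power2_eq_square algebra_simps)
  ultimately show ?thesis using K by linarith
qed

text \<open>
  Integrate the pointwise bounds and compare the resulting series term by term with the geometric
  weights of \<open>reach_square_geometric\<close>. The weights are strictly comparable and the coefficients are
  positive, hence the strict inequalities.
\<close>
lemma conditional_expectation_bounds:
  "ereal (lower_bound K) < cond_expectation M (survival_event M X s squares (K\<^sup>2))
      (\<lambda>x. hit_time X s squares x - exceed_time X s (K\<^sup>2) x)"
  "cond_expectation M (survival_event M X s squares (K\<^sup>2))
      (\<lambda>x. hit_time X s squares x - exceed_time X s (K\<^sup>2) x) < ereal (upper_bound K)"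
proof -
  define A where "A = survival_event M X s squares (K\<^sup>2)"
  define Y where "Y = (\<lambda>x. ennreal_of_enat (hit_time X s squares x - exceed_time X s (K\<^sup>2) x))"
  define w where "w = survivor_mass s K"
  define q where "q = (\<lambda>j. reach squares s (int ((K + 1 + j)\<^sup>2)))"
  define l where "l = (\<lambda>j. (real K + 1 + real j)\<^sup>2 - (real K)\<^sup>2 - 5)"
  define u where "u = (\<lambda>j. (real K + 1 + real j)\<^sup>2 - (real K)\<^sup>2 - 1)"
  have w: "w > 0" using pos by (simp add: w_def prob_survival_event)
  have lu: "l j > 0" "u j > 0" "l j \<le> u j" for j
    using square_gap_gt[of j] by (auto simp: l_def u_def)
  have q: "(5 / 7 - eps K) ^ j * (2 / 7 - eps K) * w < q j" "q j < (5 / 7 + eps K) ^ j * (2 / 7 + eps K) * w" for j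
    using reach_square_geometric[OF K s, of j] w unfolding q_def w_def by auto
  have q_nonneg: "q j \<ge> 0" for j by (simp add: q_def reach_nonneg)
  have eps: "0 < 5 / 7 - eps K" "5 / 7 - eps K < 1" "0 < 5 / 7 + eps K" "5 / 7 + eps K < 1"
    using eps_less[OF K] eps_pos[of K] by auto
  have sum_hi: "summable (\<lambda>j. u j * (5 / 7 + eps K) ^ j * (2 / 7 + eps K))"
    unfolding u_def by (intro summable_mult2 summable_quadratic_times_geometric eps)
  have sum_lo: "summable (\<lambda>j. l j * (5 / 7 - eps K) ^ j * (2 / 7 - eps K))"
    unfolding l_def by (intro summable_mult2 summable_quadratic_times_geometric eps)
  have uq: "u j * q j < u j * (5 / 7 + eps K) ^ j * (2 / 7 + eps K) * w" for j
    using mult_strict_left_mono[OF q(2)[of j] lu(2)[of j]] by (simp add: mult_ac)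
  have lq: "l j * (5 / 7 - eps K) ^ j * (2 / 7 - eps K) * w < l j * q j" for j
    using mult_strict_left_mono[OF q(1)[of j] lu(1)[of j]] by (simp add: mult_ac)
  have sum_uq: "summable (\<lambda>j. u j * q j)"
  proof (rule summable_comparison_test')
    show "summable (\<lambda>j. u j * (5 / 7 + eps K) ^ j * (2 / 7 + eps K) * w)"
      by (rule summable_mult2[OF sum_hi])
    show "norm (u j * q j) \<le> u j * (5 / 7 + eps K) ^ j * (2 / 7 + eps K) * w" if "j \<ge> 0" for j
      using uq[of j] lu(2)[of j] q_nonneg[of j] by simp
  qed
  have sum_lq: "summable (\<lambda>j. l j * q j)"
  proof (rule summable_comparison_test'[OF sum_uq])
    show "norm (l j * q j) \<le> u j * q j" if "j \<ge> 0" for j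
      using lu(1,3)[of j] q_nonneg[of j] by (simp add: mult_right_mono)
  qed
  have upper: "(\<Sum>j. u j * q j) < upper_bound K * w"
  proof -
    have "(\<Sum>j. u j * q j) < (\<Sum>j. u j * (5 / 7 + eps K) ^ j * (2 / 7 + eps K) * w)"
      by (intro suminf_strict_mono sum_uq summable_mult2[OF sum_hi] uq)
    also have "\<dots> = upper_bound K * w"
      using suminf_mult2[OF sum_hi, of w] by (simp add: upper_bound_def u_def)
    finally show ?thesis .
  qed
  have lower: "lower_bound K * w < (\<Sum>j. l j / 6 * q j)"
  proof -
    have "lower_bound K * w = 1 / 6 * (\<Sum>j. l j * (5 / 7 - eps K) ^ j * (2 / 7 - eps K) * w)"
      using suminf_mult2[OF sum_lo, of w] by (simp add: lower_bound_def l_def)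
    also have "\<dots> < 1 / 6 * (\<Sum>j. l j * q j)"
      by (intro mult_strict_left_mono suminf_strict_mono sum_lq summable_mult2[OF sum_lo] lq) simp
    also have "\<dots> = (\<Sum>j. l j / 6 * q j)"
      using suminf_mult[OF sum_lq, of "1 / 6"] by simp
    finally show ?thesis .
  qed
  have sum_lq': "summable (\<lambda>j. l j / 6 * q j)"
    using summable_mult[OF sum_lq, of "1 / 6"] by simp
  have sum_nonneg: "0 \<le> (\<Sum>j. l j / 6 * q j)"
    using lu q_nonneg by (intro suminf_nonneg sum_lq' mult_nonneg_nonneg) (auto simp: less_imp_le)
  define I where "I = (\<integral>\<^sup>+ x. Y x * indicator A x \<partial>M)"
  have E: "cond_expectation M A (\<lambda>x. hit_time X s squares x - exceed_time X s (K\<^sup>2) x) = enn2ereal (I / ennreal w)"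
  proof -
    have "(\<integral>\<^sup>+ x. Y x \<partial>uniform_measure M A) = I / emeasure M A"
      unfolding I_def Y_def A_def
      by (rule nn_integral_uniform_measure) (rule duration_measurable[OF iid] survival_event_measurable[OF iid])+
    also have "emeasure M A = ennreal w"
      by (simp add: emeasure_eq_measure A_def w_def prob_survival_event)
    finally show ?thesis by (simp add: cond_expectation_def Y_def)
  qed
  have "I \<le> (\<integral>\<^sup>+ x. (\<Sum>j. ennreal (u j) * indicator (first_hit_at M X s squares ((K + 1 + j)\<^sup>2)) x) \<partial>M)"
    unfolding I_def Y_def A_def u_def by (rule nn_integral_mono_AE[OF duration_pointwise_bounds(2)])
  also have "\<dots> = ennreal (\<Sum>j. u j * q j)"
    unfolding q_def by (rule nn_integral_first_hits) (use lu sum_uq in \<open>auto simp: q_def less_imp_le\<close>)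
  finally have "I / ennreal w \<le> ennreal ((\<Sum>j. u j * q j) / w)"
    using divide_right_mono_ennreal[of I _ "ennreal w"] w
    by (simp add: divide_ennreal[symmetric] suminf_nonneg sum_uq lu q_nonneg less_imp_le)
  hence "enn2ereal (I / ennreal w) \<le> enn2ereal (ennreal ((\<Sum>j. u j * q j) / w))"
    by (simp only: less_eq_ennreal.rep_eq)
  also have "\<dots> = ereal ((\<Sum>j. u j * q j) / w)"
    using w by (simp add: suminf_nonneg sum_uq lu q_nonneg less_imp_le)
  also have "\<dots> < ereal (upper_bound K)"
    using upper w by (simp add: pos_divide_less_eq)
  finally show "cond_expectation M (survival_event M X s squares (K\<^sup>2))
      (\<lambda>x. hit_time X s squares x - exceed_time X s (K\<^sup>2) x) < ereal (upper_bound K)"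
    unfolding E[symmetric] A_def .
  have "ereal (lower_bound K) < ereal ((\<Sum>j. l j / 6 * q j) / w)"
    using lower w by (simp add: pos_less_divide_eq)
  also have "\<dots> = enn2ereal (ennreal ((\<Sum>j. l j / 6 * q j) / w))"
    using w sum_nonneg by (simp only: enn2ereal_ennreal divide_nonneg_pos)
  also have "\<dots> \<le> enn2ereal (I / ennreal w)"
  proof -
    have "ennreal (\<Sum>j. l j / 6 * q j) = (\<integral>\<^sup>+ x. (\<Sum>j. ennreal (l j / 6) * indicator (first_hit_at M X s squares ((K + 1 + j)\<^sup>2)) x) \<partial>M)"
      unfolding q_def by (rule nn_integral_first_hits[symmetric]) (use lu sum_lq' in \<open>auto simp: q_def less_imp_le\<close>)
    also have "\<dots> \<le> I"
      unfolding I_def Y_def A_def l_def by (rule nn_integral_mono_AE[OF duration_pointwise_bounds(1)])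
    finally have "ennreal ((\<Sum>j. l j / 6 * q j) / w) \<le> I / ennreal w"
      using divide_right_mono_ennreal[of _ I "ennreal w"] w sum_nonneg
      by (simp only: divide_ennreal[symmetric])
    thus ?thesis by (simp only: less_eq_ennreal.rep_eq)
  qed
  finally show "ereal (lower_bound K) < cond_expectation M (survival_event M X s squares (K\<^sup>2))
      (\<lambda>x. hit_time X s squares x - exceed_time X s (K\<^sup>2) x)"
    unfolding E[symmetric] A_def .
qed

end

theorem proposition4:
  fixes M :: "'a measure" and X :: "nat \<Rightarrow> 'a \<Rightarrow> nat" and K N s :: nat
  assumes "iid_dice M X"
    and "K \<ge> 4" and "N = K\<^sup>2" and "s \<le> N"
    and "measure M (survival_event M X s squares N) > 0"
  shows "ereal (lower_bound K)
           < cond_expectation M (survival_event M X s squares N)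
               (\<lambda>x. hit_time X s squares x - exceed_time X s N x)
       \<and> cond_expectation M (survival_event M X s squares N)
               (\<lambda>x. hit_time X s squares x - exceed_time X s N x)
           < ereal (upper_bound K)"
  using conditional_expectation_bounds[of M X K s] assms by simp

end
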